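(* For every $z\in\mathbb{C}$ with $\underline z_1^*\le|z|\le\bar z_1^*$ the following statements hold. (i) The series defining $N_1(z)$, $G_1(z)$ and $R_1(z)$ converge absolutely, and $|N_1(z)|\le N_1(|z|)$, $|G_1(z)|\le G_1(|z|)$, $|R_1(z)|\le R_1(|z|)$ entry-wise. (ii) $G_1(z)=N_1(z)A_{*,-1}(z)$ and $R_1(z)=A_{*,1}(z)N_1(z)$. (iii) $A_{*,-1}(z)+A_{*,0}(z)G_1(z)+A_{*,1}(z)G_1(z)^2=G_1(z)$ and $R_1(z)^2A_{*,-1}(z)+R_1(z)A_{*,0}(z)+A_{*,1}(z)=R_1(z)$. (iv) With $H_1(z)=A_{*,0}(z)+A_{*,1}(z)N_1(z)A_{*,-1}(z)$, one has $(I-H_1(z))N_1(z)=I$. (v) For every nonzero $w\in\mathbb{C}$, $I-C(z,w)=\big(w^{-1}I-R_1(z)\big)\big(I-H_1(z)\big)\big(wI-G_1(z)\big)$.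
   Context: Let $\mathbb{H}=\{-1,0,1\}$, $\mathbb{H}_+=\{0,1\}$, and let $S_0=\{1,\dots,s_0\}$ be finite. Let $A_{i,j}$ ($i,j\in\mathbb{H}$), $A^{(1)}_{i,j}$ ($i\in\mathbb{H},j\in\mathbb{H}_+$), $A^{(2)}_{i,j}$ ($i\in\mathbb{H}_+,j\in\mathbb{H}$) be nonnegative $s_0\times s_0$ matrices such that $\sum A_{i,j}$, $\sum A^{(1)}_{i,j}$, $\sum A^{(2)}_{i,j}$ are stochastic. Standing assumption: the following three Markov chains are irreducible and aperiodic: the chain on $\mathbb{Z}^2\times S_0$ with transition block $A_{i,j}$ from $(x_1,x_2)$ to $(x_1+i,x_2+j)$; the chain on $\mathbb{Z}\times\mathbb{Z}_+\times S_0$ with block $A_{i,j}$ if $x_2\ne0$ and $A^{(1)}_{i,j}$ if $x_2=0$; the chain on $\mathbb{Z}_+\times\mathbb{Z}\times S_0$ with block $A_{i,j}$ if $x_1\neq0$ and $A^{(2)}_{i,j}$ if $x_1=0$. For nonzero complex $z,w$: $A_{*,j}(z)=\sum_{i\in\mathbb{H}}A_{i,j}z^i$ ($j\in\mathbb H$) and $C(z,w)=\sum_{i,j\in\mathbb{H}}A_{i,j}z^iw^j=\sum_{j\in\mathbb H}A_{*,j}(z)w^j$. For real $s_1,s_2$ let $\chi(e^{s_1},e^{s_2})=\mathrm{spr}(C(e^{s_1},e^{s_2}))$ (spectral radius); $\bar\Gamma=\{(s_1,s_2)\in\mathbb{R}^2:\chi(e^{s_1},e^{s_2})\le1\}$ is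 compact and convex and contains $(0,0)$. Put $\underline z_1^*=\exp(\min_{\bar\Gamma}s_1)$ and $\bar z_1^*=\exp(\max_{\bar\Gamma}s_1)$. (It is known that, for real $z>0$, the equations in (iii) have minimal nonnegative solutions iff $z\in[\underline z_1^*,\bar z_1^*]$.) For $n\ge1$ let $\mathscr I_n=\{(i_1,\dots,i_n)\in\mathbb{H}^n:\sum_{l=1}^ki_l\ge0\ (1\le k\le n-1),\ \sum_{l=1}^ni_l=0\}$, $\mathscr I_{D,1,n}=\{(i_1,\dots,i_n)\in\mathbb{H}^n:\sum_{l=1}^ki_l\ge0\ (1\le k\le n-1),\ \sum_{l=1}^ni_l=-1\}$, $\mathscr I_{U,1,n}=\{(i_1,\dots,i_n)\in\mathbb{H}^n:\sum_{l=1}^ki_l\ge1\ (1\le k\le n-1),\ \sum_{l=1}^ni_l=1\}$, and let $Q_{11}^{(n)}(z)$, $D_1^{(n)}(z)$, $U_1^{(n)}(z)$ be the sums of $A_{*,i_1}(z)A_{*,i_2}(z)\cdots A_{*,i_n}(z)$ over $\mathscr I_n$, $\mathscr I_{D,1,n}$, $\mathscr I_{U,1,n}$, respectively; $Q_{11}^{(0)}(z)=I$. Define $N_1(z)=\sum_{n=0}^\infty Q_{11}^{(n)}(z)$, $G_1(z)=\sum_{n=1}^\infty D_1^{(n)}(z)$, $R_1(z)=\sum_{n=1}^\infty U_1^{(n)}(z)$. For a matrix $A=(a_{ij})$, $|A|=(|a_{ij}|)$. *)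

theory Defs
  imports "HOL-Analysis.Analysis" "HOL-Library.Complex_Order"
begin

section \<open>Markov chains on a discrete state space\<close>

text \<open>The \<open>n\<close>-step transition probabilities of the chain with state space \<open>S\<close> and one-step
  transition probabilities \<open>p\<close>.\<close>

primrec n_step :: "'x set \<Rightarrow> ('x \<Rightarrow> 'x \<Rightarrow> real) \<Rightarrow> nat \<Rightarrow> 'x \<Rightarrow> 'x \<Rightarrow> real" where
  "n_step S p 0 x y = (if x = y then 1 else 0)"
| "n_step S p (Suc n) x y = (\<Sum>\<^sub>\<infinity>u\<in>S. p x u * n_step S p n u y)"

definition irreducible_chain :: "'x set \<Rightarrow> ('x \<Rightarrow> 'x \<Rightarrow> real) \<Rightarrow> bool" where
  "irreducible_chain S p \<longleftrightarrow> (\<forall>x\<in>S. \<forall>y\<in>S. \<exists>n. n_step S p n x y > 0)"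

definition aperiodic_chain :: "'x set \<Rightarrow> ('x \<Rightarrow> 'x \<Rightarrow> real) \<Rightarrow> bool" where
  "aperiodic_chain S p \<longleftrightarrow> (\<forall>x\<in>S. Gcd {n. n \<ge> 1 \<and> n_step S p n x x > 0} = 1)"

section \<open>Transition blocks\<close>

text \<open>The finite set of phases is a finite type \<open>'s\<close>. A family of blocks is a function of two
  integers; only its values on the relevant index set are ever used. The entry \<open>M $ k $ l\<close> of a
  block belongs to the transition from phase \<open>k\<close> to phase \<open>l\<close>.\<close>

type_synonym 's blocks = "int \<Rightarrow> int \<Rightarrow> real^'s^'s"

definition HH :: "int set" where "HH = {-1, 0, 1}"

definition HHp :: "int set" where "HHp = {0, 1}"

definition nonneg_mat :: "real^'s::finite^'s \<Rightarrow> bool" where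
  "nonneg_mat M \<longleftrightarrow> (\<forall>k l. M $ k $ l \<ge> 0)"

definition stochastic :: "real^'s::finite^'s \<Rightarrow> bool" where
  "stochastic M \<longleftrightarrow> nonneg_mat M \<and> (\<forall>k. (\<Sum>l\<in>UNIV. M $ k $ l) = 1)"

definition block_on :: "int set \<Rightarrow> int set \<Rightarrow> 's::finite blocks \<Rightarrow> 's blocks" where
  "block_on I J B i j = (if i \<in> I \<and> j \<in> J then B i j else 0)"

text \<open>The transition probabilities of the three chains, on \<open>\<int>\<^sup>2\<close>, on \<open>\<int> \<times> \<int>\<^sub>+\<close> and on
  \<open>\<int>\<^sub>+ \<times> \<int>\<close> (each times the phases).\<close>

fun chain0 :: "'s::finite blocks \<Rightarrow> int \<times> int \<times> 's \<Rightarrow> int \<times> int \<times> 's \<Rightarrow> real" where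
  "chain0 A (x1, x2, k) (y1, y2, l) = block_on HH HH A (y1 - x1) (y2 - x2) $ k $ l"

fun chain1 :: "'s::finite blocks \<Rightarrow> 's blocks \<Rightarrow> int \<times> int \<times> 's \<Rightarrow> int \<times> int \<times> 's \<Rightarrow> real" where
  "chain1 A A1 (x1, x2, k) (y1, y2, l) =
    (if x2 \<noteq> 0 then block_on HH HH A else block_on HH HHp A1) (y1 - x1) (y2 - x2) $ k $ l"

fun chain2 :: "'s::finite blocks \<Rightarrow> 's blocks \<Rightarrow> int \<times> int \<times> 's \<Rightarrow> int \<times> int \<times> 's \<Rightarrow> real" where
  "chain2 A A2 (x1, x2, k) (y1, y2, l) =
    (if x1 \<noteq> 0 then block_on HH HH A else block_on HHp HH A2) (y1 - x1) (y2 - x2) $ k $ l"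

definition states0 :: "(int \<times> int \<times> 's) set" where
  "states0 = UNIV"

definition states1 :: "(int \<times> int \<times> 's) set" where
  "states1 = {(x1, x2, k). x2 \<ge> 0}"

definition states2 :: "(int \<times> int \<times> 's) set" where
  "states2 = {(x1, x2, k). x1 \<ge> 0}"

section \<open>Matrix generating functions\<close>

definition A_star :: "'s::finite blocks \<Rightarrow> int \<Rightarrow> complex \<Rightarrow> complex^'s^'s" where
  "A_star A j z = (\<chi> k l. \<Sum>i\<in>HH. complex_of_real (A i j $ k $ l) * z powi i)"

definition C_mat :: "'s::finite blocks \<Rightarrow> complex \<Rightarrow> complex \<Rightarrow> complex^'s^'s" where
  "C_mat A z w =
    (\<chi> k l. \<Sum>i\<in>HH. \<Sum>j\<in>HH. complex_of_real (A i j $ k $ l) * z powi i * w powi j)"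

definition eigenvalues :: "complex^'s::finite^'s \<Rightarrow> complex set" where
  "eigenvalues M = {c. \<exists>v. v \<noteq> 0 \<and> M *v v = c *s v}"

definition spr :: "complex^'s::finite^'s \<Rightarrow> real" where
  "spr M = Max (cmod ` eigenvalues M)"

definition chi :: "'s::finite blocks \<Rightarrow> real \<Rightarrow> real \<Rightarrow> real" where
  "chi A x y = spr (C_mat A (complex_of_real x) (complex_of_real y))"

definition Gamma_bar :: "'s::finite blocks \<Rightarrow> (real \<times> real) set" where
  "Gamma_bar A = {(s1, s2). chi A (exp s1) (exp s2) \<le> 1}"

text \<open>\<open>Gamma_bar A\<close> is nonempty and compact when the chain on \<open>\<int>\<^sup>2\<close> is irreducible, so the
  infimum and the supremum of its first projection are a minimum and a maximum.\<close>

definition z1_lo :: "'s::finite blocks \<Rightarrow> real" where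
  "z1_lo A = exp (Inf (fst ` Gamma_bar A))"

definition z1_hi :: "'s::finite blocks \<Rightarrow> real" where
  "z1_hi A = exp (Sup (fst ` Gamma_bar A))"

section \<open>Path sums\<close>

definition I_set :: "nat \<Rightarrow> int list set" where
  "I_set n = {xs. length xs = n \<and> set xs \<subseteq> HH \<and>
     (\<forall>k\<in>{1..n - 1}. sum_list (take k xs) \<ge> 0) \<and> sum_list xs = 0}"

definition I_D_set :: "nat \<Rightarrow> int list set" where
  "I_D_set n = {xs. length xs = n \<and> set xs \<subseteq> HH \<and>
     (\<forall>k\<in>{1..n - 1}. sum_list (take k xs) \<ge> 0) \<and> sum_list xs = -1}"

definition I_U_set :: "nat \<Rightarrow> int list set" where
  "I_U_set n = {xs. length xs = n \<and> set xs \<subseteq> HH \<and>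
     (\<forall>k\<in>{1..n - 1}. sum_list (take k xs) \<ge> 1) \<and> sum_list xs = 1}"

definition path_prod :: "'s::finite blocks \<Rightarrow> complex \<Rightarrow> int list \<Rightarrow> complex^'s^'s" where
  "path_prod A z xs = foldr (\<lambda>i M. A_star A i z ** M) xs (mat 1)"

definition Q11 :: "'s::finite blocks \<Rightarrow> nat \<Rightarrow> complex \<Rightarrow> complex^'s^'s" where
  "Q11 A n z = (if n = 0 then mat 1 else \<Sum>xs\<in>I_set n. path_prod A z xs)"

definition D1 :: "'s::finite blocks \<Rightarrow> nat \<Rightarrow> complex \<Rightarrow> complex^'s^'s" where
  "D1 A n z = (\<Sum>xs\<in>I_D_set n. path_prod A z xs)"

definition U1 :: "'s::finite blocks \<Rightarrow> nat \<Rightarrow> complex \<Rightarrow> complex^'s^'s" where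
  "U1 A n z = (\<Sum>xs\<in>I_U_set n. path_prod A z xs)"

definition N1 :: "'s::finite blocks \<Rightarrow> complex \<Rightarrow> complex^'s^'s" where
  "N1 A z = (\<Sum>n. Q11 A n z)"

text \<open>The next two series start at \<open>n = 1\<close>.\<close>

definition G1 :: "'s::finite blocks \<Rightarrow> complex \<Rightarrow> complex^'s^'s" where
  "G1 A z = (\<Sum>n. D1 A (Suc n) z)"

definition R1 :: "'s::finite blocks \<Rightarrow> complex \<Rightarrow> complex^'s^'s" where
  "R1 A z = (\<Sum>n. U1 A (Suc n) z)"

definition H1 :: "'s::finite blocks \<Rightarrow> complex \<Rightarrow> complex^'s^'s" where
  "H1 A z = A_star A 0 z + A_star A 1 z ** N1 A z ** A_star A (-1) z"

definition abs_summable_mat :: "(nat \<Rightarrow> complex^'s::finite^'s) \<Rightarrow> bool" where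
  "abs_summable_mat F \<longleftrightarrow> (\<forall>k l. summable (\<lambda>n. cmod (F n $ k $ l)))"

definition mat_abs :: "complex^'s::finite^'s \<Rightarrow> complex^'s^'s" where
  "mat_abs M = (\<chi> k l. complex_of_real (cmod (M $ k $ l)))"

text \<open>Here \<open>\<le>\<close> is the order of \<open>Complex_Order\<close>: \<open>a \<le> b\<close> means that the real parts are ordered
  and the imaginary parts agree. As the left-hand side will be real, so is the right-hand side.\<close>

definition mat_le :: "complex^'s::finite^'s \<Rightarrow> complex^'s^'s \<Rightarrow> bool" where
  "mat_le M M' \<longleftrightarrow> (\<forall>k l. M $ k $ l \<le> M' $ k $ l)"

end

(* If ln |z| lies in the projection of Gamma_bar, there are w > 0 and a positive vector v with
   C(|z|, w) v \<le> v. Such a v bounds the total weight of the first passages from level 0 to level -1,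
   so those sums converge; by irreducibility a fixed first passage of positive weight can be appended
   to every excursion, so the excursion sums N_1 converge too. Splitting an excursion at its first
   return to level 0 gives N_1 = I + H_1 N_1, and the identities follow from this equation,
   G_1 = N_1 A_{*,-1} and R_1 = A_{*,1} N_1. That ln |z| lies in the projection for every z in the
   closed annulus is a matter of compactness (irreducibility gives returns to a phase with any
   displacement, which bounds Gamma_bar) and convexity (in logarithmic coordinates). *)

theory Submission
  imports Defs
begin

section \<open>Perron vectors and the spectral radius\<close>

text \<open>\<open>spr\<close> is a maximum over complex eigenvalues, which is awkward to vary with
  \<open>s1\<close> and \<open>s2\<close>. It is therefore traded for the existence of a nonnegative
  vector v with C v \<le> v, normalised to coordinate sum 1. One direction needs a nonnegative
  eigenvector, obtained from Brouwer's theorem; the other needs v to be positive, which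
  irreducibility enforces. In this form closedness is visible, and convexity reduces to that of
  \<open>exp\<close>. At the two ends of the annulus the spectral radius cannot be pushed below 1,
  so there is no geometric decay in the path length. Convergence has to come from bounded partial
  sums of nonnegative weights, and this is why v only has to satisfy a weak inequality. The sums are
  taken as unordered sums over sets of paths. Bijections between such sets become matrix identities,
  and grouping by length recovers the series over n. Since the blocks do not commute, both N = I + H
  N and its mirror image N = I + N H are wanted; the second follows because inverses of square
  matrices are two-sided.\<close>

definition cmat :: "real^'s^'s \<Rightarrow> complex^'s^'s" where
  "cmat M = (\<chi> k l. complex_of_real (M $ k $ l))"

text \<open>Normalised candidates for Perron vectors: a compact convex domain for Brouwer's theorem,
  and later the compact factor over which the vector v ranges.\<close>

definition prob_simplex :: "(real^'s::finite) set" where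
  "prob_simplex = {v. (\<forall>k. 0 \<le> v $ k) \<and> (\<Sum>k\<in>UNIV. v $ k) = 1}"

lemma prob_simplexD:
  assumes "v \<in> prob_simplex"
  shows "0 \<le> v $ k" and "(\<Sum>k\<in>UNIV. v $ k) = 1"
  using assms by (auto simp: prob_simplex_def)

lemma prob_simplex_nonzero: "v \<in> prob_simplex \<Longrightarrow> v \<noteq> 0"
  by (auto simp: prob_simplex_def)

lemma prob_simplex_pos:
  assumes "v \<in> prob_simplex"
  obtains k where "0 < v $ k"
  using prob_simplex_nonzero[OF assms] prob_simplexD(1)[OF assms]
  by (metis less_eq_real_def vec_eq_iff zero_index)

lemma normalize_in_prob_simplex:
  assumes "\<And>k. 0 \<le> v $ k" and "(\<Sum>k\<in>UNIV. v $ k) \<noteq> 0"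
  shows "inverse (\<Sum>k\<in>UNIV. v $ k) *\<^sub>R v \<in> prob_simplex"
  using assms by (simp add: prob_simplex_def sum_nonneg flip: sum_distrib_left)

lemma compact_prob_simplex: "compact (prob_simplex :: (real^'s::finite) set)"
proof -
  have "prob_simplex = (\<Inter>k. {v :: real^'s. 0 \<le> v $ k}) \<inter> {v. (\<Sum>k\<in>UNIV. v $ k) = 1}"
    by (auto simp: prob_simplex_def)
  also have "closed \<dots>"
    by (intro closed_Int closed_INT ballI closed_Collect_le closed_Collect_eq continuous_intros)
  finally have "closed (prob_simplex :: (real^'s) set)" .
  moreover have "bounded (prob_simplex :: (real^'s) set)"
  proof (rule boundedI)
    fix v :: "real^'s" assume v: "v \<in> prob_simplex"
    have "norm v \<le> (\<Sum>k\<in>UNIV. \<bar>v $ k\<bar>)" by (rule norm_le_l1_cart)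
    also have "\<dots> = 1" using prob_simplexD[OF v] by simp
    finally show "norm v \<le> 1" .
  qed
  ultimately show ?thesis by (simp add: compact_eq_bounded_closed)
qed

lemma convex_prob_simplex: "convex (prob_simplex :: (real^'s::finite) set)"
  by (auto simp: prob_simplex_def convex_def sum.distrib simp flip: sum_distrib_left)

lemma prob_simplex_nonempty: "prob_simplex \<noteq> ({} :: (real^'s::finite) set)"
proof -
  have "(\<chi> k. 1 / real CARD('s)) \<in> (prob_simplex :: (real^'s) set)"
    by (simp add: prob_simplex_def)
  then show ?thesis by blast
qed

text \<open>The weak Perron-Frobenius theorem, from a fixed point of the normalised map v + M v on
  the simplex. Adding v leaves the eigenvectors unchanged and keeps the normalising factor 1 + t v
  at least 1, even where M v = 0.\<close>

lemma nonneg_eigenvector: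
  fixes M :: "real^'s::finite^'s"
  assumes M: "\<And>k l. 0 \<le> M $ k $ l"
  obtains v r where "v \<in> prob_simplex" "0 \<le> r" "M *v v = r *\<^sub>R v"
proof -
  define t :: "real^'s \<Rightarrow> real" where "t v = (\<Sum>k\<in>UNIV. (M *v v) $ k)" for v
  define f where "f v = inverse (1 + t v) *\<^sub>R (v + M *v v)" for v
  have nn: "0 \<le> (M *v v) $ k" if "v \<in> prob_simplex" for v k
    using prob_simplexD(1)[OF that] M by (simp add: matrix_vector_mult_def sum_nonneg)
  have t: "0 \<le> t v" if "v \<in> prob_simplex" for v
    using nn[OF that] by (simp add: t_def sum_nonneg)
  have ct: "continuous_on prob_simplex t"
    unfolding t_def by (intro continuous_intros)
  have "continuous_on prob_simplex f"
    unfolding f_def using t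
    by (intro continuous_intros ct) (auto simp: add_nonneg_eq_0_iff)
  moreover have "f \<in> prob_simplex \<rightarrow> prob_simplex"
  proof
    fix v :: "real^'s" assume v: "v \<in> prob_simplex"
    have eq: "(\<Sum>k\<in>UNIV. (v + M *v v) $ k) = 1 + t v"
      using prob_simplexD(2)[OF v] by (simp add: sum.distrib t_def)
    then show "f v \<in> prob_simplex"
      using normalize_in_prob_simplex[of "v + M *v v"] nn[OF v] prob_simplexD(1)[OF v] t[OF v]
      by (auto simp: f_def)
  qed
  ultimately obtain v where v: "v \<in> prob_simplex" "f v = v"
    using brouwer[OF compact_prob_simplex convex_prob_simplex prob_simplex_nonempty] by metis
  have "v + M *v v = (1 + t v) *\<^sub>R f v"
    using t[OF v(1)] by (simp add: f_def)
  then have "M *v v = t v *\<^sub>R v"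
    using v(2) by (simp add: scaleR_left_distrib)
  then show ?thesis using that v(1) t by blast
qed

lemma of_real_eigenvalue:
  assumes v: "v \<noteq> 0" and Mv: "M *v v = r *\<^sub>R v"
  shows "complex_of_real r \<in> eigenvalues (cmat M)"
proof -
  define u where "u = (\<chi> k. complex_of_real (v $ k))"
  have "cmat M *v u = complex_of_real r *s u"
    using Mv by (simp add: vec_eq_iff cmat_def u_def matrix_vector_mult_def
      flip: of_real_mult of_real_sum)
  moreover have "u \<noteq> 0" using v by (auto simp: u_def vec_eq_iff)
  ultimately show ?thesis by (auto simp: eigenvalues_def)
qed

text \<open>A Collatz-Wielandt bound: the eigenvalue equation is read in the coordinate
  \<open>k\<close> where |v_k| / u_k is largest, so that every other |v_l| can be replaced by q k *
  u l.\<close>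

lemma eigenvalue_norm_le:
  fixes M :: "complex^'s::finite^'s"
  assumes c: "c \<in> eigenvalues M" and u: "\<And>k. 0 < u k"
    and le: "\<And>k. (\<Sum>l\<in>UNIV. cmod (M $ k $ l) * u l) \<le> r * u k"
  shows "cmod c \<le> r"
proof -
  obtain v where v: "v \<noteq> 0" "M *v v = c *s v"
    using c by (auto simp: eigenvalues_def)
  define q where "q k = cmod (v $ k) / u k" for k
  have "Max (range q) \<in> range q" by (intro Max_in) auto
  then obtain k where "Max (range q) = q k" by (rule rangeE)
  then have max: "q l \<le> q k" for l
    by (metis Max_ge finite finite_imageI rangeI)
  obtain l0 where "v $ l0 \<noteq> 0" using v(1) by (auto simp: vec_eq_iff)
  then have "0 < q l0" using u by (simp add: q_def)
  then have qk: "0 < q k" using max[of l0] by linarith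
  have vq: "cmod (v $ l) = q l * u l" for l using u[of l] by (simp add: q_def)
  have "cmod c * (q k * u k) = cmod ((M *v v) $ k)"
    using v(2) by (simp add: norm_mult vq flip: vq)
  also have "\<dots> \<le> (\<Sum>l\<in>UNIV. cmod (M $ k $ l) * (q l * u l))"
    unfolding matrix_vector_mult_def by (simp add: vq[symmetric] norm_mult sum_norm_le)
  also have "\<dots> \<le> (\<Sum>l\<in>UNIV. cmod (M $ k $ l) * (q k * u l))"
    using max u by (intro sum_mono mult_left_mono mult_right_mono) (auto simp: less_imp_le)
  also have "\<dots> = q k * (\<Sum>l\<in>UNIV. cmod (M $ k $ l) * u l)"
    by (simp add: sum_distrib_left mult_ac)
  also have "\<dots> \<le> q k * (r * u k)"
    using le qk by (intro mult_left_mono) auto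
  finally have "cmod c * (q k * u k) \<le> r * (q k * u k)" by (simp add: mult_ac)
  then show ?thesis using qk u[of k] by (simp add: mult_le_cancel_right)
qed

lemma eigenvalues_iff_det:
  fixes M :: "complex^'s::finite^'s"
  shows "c \<in> eigenvalues M \<longleftrightarrow> det (mat c - M) = 0"
proof -
  have "mat c *v v = c *s v" for v :: "complex^'s"
    by (simp add: matrix_vector_mult_def mat_def vec_eq_iff if_distrib[of "\<lambda>x. x * _"] cong: if_cong)
  then have "(mat c - M) *v v = 0 \<longleftrightarrow> M *v v = c *s v" for v
    by (auto simp: matrix_vector_mult_diff_rdistrib)
  then have "c \<in> eigenvalues M \<longleftrightarrow> \<not> invertible (mat c - M)"
    unfolding eigenvalues_def invertible_left_inverse matrix_left_invertible_ker by blast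
  then show ?thesis by (simp add: invertible_det_nz)
qed

text \<open>Makes the \<open>Max\<close> in \<open>spr\<close> meaningful. The characteristic
  polynomial is written out by the Leibniz formula; it is not the zero polynomial because no
  eigenvalue exceeds the sum \<open>r\<close> of all entry moduli, so \<open>r + 1\<close> is not a
  root.\<close>

lemma finite_eigenvalues:
  fixes M :: "complex^'s::finite^'s"
  shows "finite (eigenvalues M)"
proof -
  define p :: "complex poly" where
    "p = (\<Sum>\<pi> | \<pi> permutes (UNIV :: 's set). of_int (sign \<pi>) *
      (\<Prod>k\<in>UNIV. [:- (M $ k $ \<pi> k), if k = \<pi> k then 1 else 0:]))"
  have p: "poly p c = det (mat c - M)" for c
    unfolding p_def det_def
    by (auto simp: poly_sum poly_prod mat_def intro!: sum.cong prod.cong)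
  define r where "r = (\<Sum>k\<in>UNIV. \<Sum>l\<in>UNIV. cmod (M $ k $ l))"
  have "(\<Sum>l\<in>UNIV. cmod (M $ k $ l)) \<le> r" for k
    unfolding r_def by (intro member_le_sum) (auto simp: sum_nonneg)
  then have "cmod c \<le> r" if "c \<in> eigenvalues M" for c
    using eigenvalue_norm_le[OF that, of "\<lambda>_. 1" r] by simp
  moreover have "0 \<le> r" by (simp add: r_def sum_nonneg)
  ultimately have "complex_of_real (r + 1) \<notin> eigenvalues M"
    by (metis abs_of_nonneg add_increasing2 less_add_one norm_of_real not_less zero_le_one)
  then have "poly p (complex_of_real (r + 1)) \<noteq> 0"
    by (simp add: p eigenvalues_iff_det)
  then have "p \<noteq> 0" by force
  then show ?thesis
    using poly_roots_finite[of p] by (simp add: p flip: eigenvalues_iff_det)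
qed

lemma spr_le_1D:
  fixes M :: "real^'s::finite^'s"
  assumes M: "\<And>k l. 0 \<le> M $ k $ l" and spr: "spr (cmat M) \<le> 1"
  obtains v where "v \<in> prob_simplex" "\<And>k. (M *v v) $ k \<le> v $ k"
proof -
  obtain v r where v: "v \<in> prob_simplex" "0 \<le> r" "M *v v = r *\<^sub>R v"
    using nonneg_eigenvector[of M] M by metis
  have "complex_of_real r \<in> eigenvalues (cmat M)"
    using v by (intro of_real_eigenvalue prob_simplex_nonzero)
  then have "cmod (complex_of_real r) \<le> spr (cmat M)"
    unfolding spr_def by (intro Max_ge finite_imageI finite_eigenvalues imageI)
  then have "r \<le> 1" using spr v(2) by simp
  then have "(M *v v) $ k \<le> v $ k" for k
    using v prob_simplexD(1)[OF v(1), of k] by (simp add: mult_left_le_one_le)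
  then show ?thesis using that v(1) by blast
qed

lemma spr_le_1I:
  fixes M :: "real^'s::finite^'s"
  assumes M: "\<And>k l. 0 \<le> M $ k $ l" and v: "\<And>k. 0 < v $ k" "\<And>k. (M *v v) $ k \<le> v $ k"
  shows "spr (cmat M) \<le> 1"
proof -
  \<comment> \<open>\<open>Max\<close> of the empty set is unspecified, so some eigenvalue has to be
    exhibited before the bound on all of them is of use.\<close>
  obtain u r where u: "u \<in> prob_simplex" "M *v u = r *\<^sub>R u"
    using nonneg_eigenvector[of M] M by metis
  then have ne: "eigenvalues (cmat M) \<noteq> {}"
    using of_real_eigenvalue[OF prob_simplex_nonzero] by blast
  have "cmod c \<le> 1" if "c \<in> eigenvalues (cmat M)" for c
    using eigenvalue_norm_le[OF that, of "\<lambda>k. v $ k" 1] v M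
    by (simp add: cmat_def matrix_vector_mult_def)
  then show ?thesis
    unfolding spr_def using ne finite_eigenvalues by (subst Max_le_iff) auto
qed

section \<open>Supersolutions and the projection of the region \<open>Gamma_bar\<close>\<close>

lemma n_step_nonneg:
  assumes "\<And>x y. 0 \<le> p x y"
  shows "0 \<le> n_step S p n x y"
  by (induction n arbitrary: x) (auto intro!: infsum_nonneg mult_nonneg_nonneg assms)

lemma n_step_SucD:
  assumes p: "\<And>x y. 0 \<le> p x y" and pos: "0 < n_step S p (Suc n) x y"
  obtains u where "u \<in> S" "0 < p x u" "0 < n_step S p n u y"
proof -
  have "\<exists>u\<in>S. p x u * n_step S p n u y \<noteq> 0"
  proof (rule ccontr)
    assume "\<not> ?thesis"
    then have "(\<Sum>\<^sub>\<infinity>u\<in>S. p x u * n_step S p n u y) = 0"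
      by (intro infsum_0) blast
    then show False using pos by simp
  qed
  then show ?thesis
    using that p n_step_nonneg[of p S n] by (metis less_eq_real_def mult_eq_0_iff)
qed

definition exp_C :: "'s::finite blocks \<Rightarrow> real \<Rightarrow> real \<Rightarrow> real^'s^'s" where
  "exp_C A s1 s2 =
    (\<chi> k l. \<Sum>i\<in>HH. \<Sum>j\<in>HH. A i j $ k $ l * exp (of_int i * s1 + of_int j * s2))"

text \<open>Only nonnegativity is asked of v, so that the condition is closed in (s1, s2, v); strict
  positivity is recovered from irreducibility.\<close>

definition supersol :: "'s::finite blocks \<Rightarrow> real \<Rightarrow> real \<Rightarrow> real^'s \<Rightarrow> bool" where
  "supersol A s1 s2 v \<longleftrightarrow> (\<forall>k. 0 \<le> v $ k) \<and> (\<forall>k. (exp_C A s1 s2 *v v) $ k \<le> v $ k)"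

lemma C_mat_exp:
  "C_mat A (complex_of_real (exp s1)) (complex_of_real (exp s2)) = cmat (exp_C A s1 s2)"
proof -
  have "complex_of_real (exp s) powi i = complex_of_real (exp (of_int i * s))" for s i
    by (simp add: exp_power_int flip: of_real_power_int)
  then have "C_mat A (complex_of_real (exp s1)) (complex_of_real (exp s2)) = (\<chi> k l. \<Sum>i\<in>HH. \<Sum>j\<in>HH.
      complex_of_real (A i j $ k $ l) * complex_of_real (exp (of_int i * s1)) *
      complex_of_real (exp (of_int j * s2)))"
    by (simp only: C_mat_def)
  also have "\<dots> = cmat (exp_C A s1 s2)"
    by (simp add: cmat_def exp_C_def vec_eq_iff exp_add mult.assoc)
  finally show ?thesis .
qed

lemma finite_HH [simp]: "finite HH"
  by (simp add: HH_def)

locale irreducible_blocks =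
  fixes A :: "'s::finite blocks"
  assumes nonneg: "\<And>i j k l. i \<in> HH \<Longrightarrow> j \<in> HH \<Longrightarrow> 0 \<le> A i j $ k $ l"
    and row_sum: "\<And>k. (\<Sum>l\<in>UNIV. \<Sum>i\<in>HH. \<Sum>j\<in>HH. A i j $ k $ l) = 1"
    and irreducible: "irreducible_chain states0 (chain0 A)"
begin

lemma chain0_nonneg: "0 \<le> chain0 A x y"
  by (cases x; cases y) (auto simp: block_on_def nonneg)

lemma chain0_pos:
  assumes "0 < chain0 A (x1, x2, k) (y1, y2, l)"
  shows "y1 - x1 \<in> HH" "y2 - x2 \<in> HH" "0 < A (y1 - x1) (y2 - x2) $ k $ l"
  using assms by (auto simp: block_on_def split: if_splits)

lemma exp_C_nonneg: "0 \<le> exp_C A s1 s2 $ k $ l"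
  by (auto simp: exp_C_def intro!: sum_nonneg mult_nonneg_nonneg nonneg)

lemma exp_C_ge:
  assumes "i \<in> HH" "j \<in> HH"
  shows "A i j $ k $ l * exp (of_int i * s1 + of_int j * s2) \<le> exp_C A s1 s2 $ k $ l"
proof -
  have "A i j $ k $ l * exp (of_int i * s1 + of_int j * s2)
      \<le> (\<Sum>j\<in>HH. A i j $ k $ l * exp (of_int i * s1 + of_int j * s2))"
    using assms by (intro member_le_sum) (auto intro!: mult_nonneg_nonneg nonneg)
  also have "\<dots> \<le> exp_C A s1 s2 $ k $ l"
    unfolding exp_C_def using assms
    by (simp, intro member_le_sum) (auto intro!: sum_nonneg mult_nonneg_nonneg nonneg)
  finally show ?thesis .
qed

text \<open>Iterating C v \<le> v along one path of positive probability; the exponents telescope to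
  the total displacement. The constant c is the product of the transition probabilities on that
  path, hence the same for all s1, s2 and v, and this uniformity is what bounds the region.\<close>

lemma supersol_along_path:
  assumes "0 < n_step states0 (chain0 A) n (x1, x2, k) (y1, y2, l)"
  shows "\<exists>c>0. \<forall>s1 s2 v. supersol A s1 s2 v \<longrightarrow>
    c * exp (of_int (y1 - x1) * s1 + of_int (y2 - x2) * s2) * v $ l \<le> v $ k"
  using assms
proof (induction n arbitrary: x1 x2 k)
  case 0
  then show ?case by (auto split: if_splits intro!: exI[of _ 1])
next
  case (Suc n)
  from n_step_SucD[OF chain0_nonneg Suc.prems] obtain u1 u2 m where
    u: "0 < chain0 A (x1, x2, k) (u1, u2, m)"
       "0 < n_step states0 (chain0 A) n (u1, u2, m) (y1, y2, l)"
    by (metis prod_cases3)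
  note step = chain0_pos[OF u(1)]
  let ?a = "A (u1 - x1) (u2 - x2) $ k $ m"
  obtain c where c: "c > 0" and le: "supersol A s1 s2 v \<Longrightarrow>
    c * exp (of_int (y1 - u1) * s1 + of_int (y2 - u2) * s2) * v $ l \<le> v $ m" for s1 s2 v
    using Suc.IH[OF u(2)] by blast
  have "?a * c * exp (of_int (y1 - x1) * s1 + of_int (y2 - x2) * s2) * v $ l \<le> v $ k"
    if v: "supersol A s1 s2 v" for s1 s2 v
  proof -
    let ?e = "exp (of_int (u1 - x1) * s1 + of_int (u2 - x2) * s2)"
    have v0: "0 \<le> v $ i" for i using v by (simp add: supersol_def)
    have "?a * c * exp (of_int (y1 - x1) * s1 + of_int (y2 - x2) * s2) * v $ l
        = ?a * ?e * (c * exp (of_int (y1 - u1) * s1 + of_int (y2 - u2) * s2) * v $ l)"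
      by (simp add: algebra_simps flip: exp_add)
    also have "\<dots> \<le> ?a * ?e * v $ m"
      using step(3) by (intro mult_left_mono le v) auto
    also have "\<dots> \<le> exp_C A s1 s2 $ k $ m * v $ m"
      by (intro mult_right_mono exp_C_ge step v0)
    also have "\<dots> \<le> (exp_C A s1 s2 *v v) $ k"
      unfolding matrix_vector_mult_def
      by (simp, intro member_le_sum) (auto intro!: mult_nonneg_nonneg exp_C_nonneg v0)
    also have "\<dots> \<le> v $ k" using v by (simp add: supersol_def)
    finally show ?thesis .
  qed
  then show ?case using step(3) c by (intro exI[of _ "?a * c"]) auto
qed

lemma reachable: "\<exists>n. 0 < n_step states0 (chain0 A) n x y"
  using irreducible unfolding irreducible_chain_def states0_def by blast

text \<open>A path with zero displacement from \<open>k\<close> to a phase \<open>l\<close> with v_l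
  > 0 carries positivity over to \<open>k\<close>.\<close>

lemma supersol_pos:
  assumes "supersol A s1 s2 v" and "v \<in> prob_simplex"
  shows "0 < v $ k"
proof -
  obtain l where l: "0 < v $ l" using prob_simplex_pos[OF assms(2)] .
  obtain n where "0 < n_step states0 (chain0 A) n (0, 0, k) (0, 0, l)"
    using reachable by blast
  from supersol_along_path[OF this] obtain c where "c > 0" "c * v $ l \<le> v $ k"
    using assms(1) by auto
  then show ?thesis using l by (meson less_le_trans mult_pos_pos)
qed

lemma supersol_direction_bound:
  "\<exists>B. \<forall>s1 s2 v. supersol A s1 s2 v \<longrightarrow> v \<in> prob_simplex \<longrightarrow>
    of_int d1 * s1 + of_int d2 * s2 \<le> B"
proof -
  fix k :: 's
  obtain n where "0 < n_step states0 (chain0 A) n (0, 0, k) (d1, d2, k)"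
    using reachable by blast
  from supersol_along_path[OF this] obtain c where c: "c > 0"
    and le: "supersol A s1 s2 v \<Longrightarrow> c * exp (of_int d1 * s1 + of_int d2 * s2) * v $ k \<le> v $ k"
    for s1 s2 v by auto
  have "of_int d1 * s1 + of_int d2 * s2 \<le> - ln c"
    if v: "supersol A s1 s2 v" "v \<in> prob_simplex" for s1 s2 v
  proof -
    \<comment> \<open>The path ends in the phase where it starts, so the positive factor
      \<open>v $ k\<close> cancels and the bound no longer depends on v.\<close>
    have "c * exp (of_int d1 * s1 + of_int d2 * s2) \<le> 1"
      using le[OF v(1)] supersol_pos[OF v, of k] by simp
    then have "exp (of_int d1 * s1 + of_int d2 * s2) \<le> exp (- ln c)"
      using c by (simp add: exp_minus field_simps)
    then show ?thesis by simp
  qed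
  then show ?thesis by blast
qed

lemma Gamma_bar_iff: "(s1, s2) \<in> Gamma_bar A \<longleftrightarrow> (\<exists>v\<in>prob_simplex. supersol A s1 s2 v)"
proof
  assume "(s1, s2) \<in> Gamma_bar A"
  then have "spr (cmat (exp_C A s1 s2)) \<le> 1"
    by (simp add: Gamma_bar_def chi_def C_mat_exp)
  then show "\<exists>v\<in>prob_simplex. supersol A s1 s2 v"
    using spr_le_1D[OF exp_C_nonneg] prob_simplexD(1) unfolding supersol_def by metis
next
  assume "\<exists>v\<in>prob_simplex. supersol A s1 s2 v"
  then obtain v where "v \<in> prob_simplex" "supersol A s1 s2 v" by blast
  then have "spr (cmat (exp_C A s1 s2)) \<le> 1"
    by (intro spr_le_1I[of _ v] exp_C_nonneg supersol_pos) (auto simp: supersol_def)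
  then show "(s1, s2) \<in> Gamma_bar A"
    by (simp add: Gamma_bar_def chi_def C_mat_exp)
qed

section \<open>Compactness and convexity of the projection to the first coordinate\<close>

lemma compact_fst_Gamma_bar: "compact (fst ` Gamma_bar A)"
proof -
  have "\<exists>B. \<forall>s1 s2 v. supersol A s1 s2 v \<longrightarrow> v \<in> prob_simplex \<longrightarrow> s1 \<le> B"
    using supersol_direction_bound[of 1 0] by simp
  moreover have "\<exists>B. \<forall>s1 s2 v. supersol A s1 s2 v \<longrightarrow> v \<in> prob_simplex \<longrightarrow> - s1 \<le> B"
    using supersol_direction_bound[of "-1" 0] by simp
  moreover have "\<exists>B. \<forall>s1 s2 v. supersol A s1 s2 v \<longrightarrow> v \<in> prob_simplex \<longrightarrow> s2 \<le> B"
    using supersol_direction_bound[of 0 1] by simp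
  moreover have "\<exists>B. \<forall>s1 s2 v. supersol A s1 s2 v \<longrightarrow> v \<in> prob_simplex \<longrightarrow> - s2 \<le> B"
    using supersol_direction_bound[of 0 "-1"] by simp
  ultimately obtain B1 B2 B3 B4 where B: "\<And>s1 s2 v. supersol A s1 s2 v \<Longrightarrow> v \<in> prob_simplex \<Longrightarrow>
    s1 \<le> B1 \<and> - s1 \<le> B2 \<and> s2 \<le> B3 \<and> - s2 \<le> B4"
    by (elim exE) blast
  \<comment> \<open>The vector is kept as a third component: membership is then given by continuous
    inequalities inside a compact box, and the projection is a continuous image of a compact
    set.\<close>
  define T :: "(real \<times> real \<times> (real^'s)) set" where
    "T = ({- B2..B1} \<times> {- B4..B3} \<times> prob_simplex) \<inter>
      (\<Inter>k. {p. (exp_C A (fst p) (fst (snd p)) *v snd (snd p)) $ k \<le> snd (snd p) $ k})"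
  have "closed {p. (exp_C A (fst p) (fst (snd p)) *v snd (snd p)) $ k \<le> snd (snd p) $ k}" for k
    unfolding exp_C_def matrix_vector_mult_def vec_lambda_beta
    by (intro closed_Collect_le continuous_intros)
  then have "compact T"
    unfolding T_def by (intro compact_Int_closed compact_Times compact_prob_simplex closed_INT) auto
  then have "compact (fst ` T)"
    by (intro compact_continuous_image continuous_intros)
  also have "fst ` T = fst ` Gamma_bar A"
  proof -
    have "(s1, s2) \<in> Gamma_bar A \<longleftrightarrow> (\<exists>v. (s1, s2, v) \<in> T)" for s1 s2
      unfolding Gamma_bar_iff
    proof safe
      fix v assume v: "v \<in> prob_simplex" "supersol A s1 s2 v"
      then have "(s1, s2, v) \<in> T"
        using B[OF v(2,1)] by (auto simp: T_def supersol_def)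
      then show "\<exists>v. (s1, s2, v) \<in> T" ..
    next
      fix v assume "(s1, s2, v) \<in> T"
      then show "\<exists>v\<in>prob_simplex. supersol A s1 s2 v"
        by (auto simp: T_def supersol_def dest: prob_simplexD(1))
    qed
    then show ?thesis by (force simp: image_iff)
  qed
  finally show ?thesis .
qed

lemma zero_in_Gamma_bar: "(0, 0) \<in> Gamma_bar A"
proof -
  have "spr (cmat (exp_C A 0 0)) \<le> 1"
    by (rule spr_le_1I[of _ "\<chi> k. 1"])
      (simp_all add: exp_C_nonneg exp_C_def matrix_vector_mult_def row_sum sum_nonneg nonneg)
  then show ?thesis
    using C_mat_exp[of A 0 0] by (simp add: Gamma_bar_def chi_def)
qed

text \<open>In the coordinates \<open>w = ln v\<close> the supersolution inequalities are sublevel conditions of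
  sums of exponentials of linear forms, hence jointly convex in \<open>(s1, s2, w)\<close>.\<close>

definition log_ratio :: "real \<Rightarrow> real \<Rightarrow> ('s \<Rightarrow> real) \<Rightarrow> 's \<Rightarrow> real" where
  "log_ratio s1 s2 w k = (\<Sum>l\<in>UNIV. \<Sum>i\<in>HH. \<Sum>j\<in>HH.
    A i j $ k $ l * exp (of_int i * s1 + of_int j * s2 + w l - w k))"

lemma supersol_exp_iff:
  "supersol A s1 s2 (\<chi> k. exp (w k)) \<longleftrightarrow> (\<forall>k. log_ratio s1 s2 w k \<le> 1)"
proof -
  have "(exp_C A s1 s2 *v (\<chi> k. exp (w k))) $ k = log_ratio s1 s2 w k * exp (w k)" for k
    by (simp add: exp_C_def matrix_vector_mult_def log_ratio_def sum_distrib_right mult.assoc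
      flip: exp_add)
  then show ?thesis by (simp add: supersol_def)
qed

text \<open>The normalisation of v is dropped here, since convex combinations of logarithms do not
  respect it; positivity of \<open>exp\<close> is enough to return to the spectral radius.\<close>

lemma mem_fst_Gamma_bar_iff:
  "s1 \<in> fst ` Gamma_bar A \<longleftrightarrow> (\<exists>s2 w. \<forall>k. log_ratio s1 s2 w k \<le> 1)"
proof
  assume "s1 \<in> fst ` Gamma_bar A"
  then obtain s2 v where v: "v \<in> prob_simplex" "supersol A s1 s2 v"
    using Gamma_bar_iff by force
  then have "v = (\<chi> k. exp (ln (v $ k)))"
    using supersol_pos by (simp add: vec_eq_iff)
  then show "\<exists>s2 w. \<forall>k. log_ratio s1 s2 w k \<le> 1"
    using v(2) supersol_exp_iff by metis
next
  assume "\<exists>s2 w. \<forall>k. log_ratio s1 s2 w k \<le> 1"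
  then obtain s2 w where "supersol A s1 s2 (\<chi> k. exp (w k))"
    using supersol_exp_iff by blast
  then have "spr (cmat (exp_C A s1 s2)) \<le> 1"
    by (intro spr_le_1I[of _ "\<chi> k. exp (w k)"] exp_C_nonneg) (auto simp: supersol_def)
  then have "(s1, s2) \<in> Gamma_bar A"
    by (simp add: Gamma_bar_def chi_def C_mat_exp)
  then show "s1 \<in> fst ` Gamma_bar A" by force
qed

lemma convex_fst_Gamma_bar: "convex (fst ` Gamma_bar A)"
proof (rule convexI)
  fix x y a b :: real
  assume ab: "0 \<le> a" "0 \<le> b" "a + b = 1"
    and xy: "x \<in> fst ` Gamma_bar A" "y \<in> fst ` Gamma_bar A"
  from xy obtain x2 w y2 w' where
    w: "\<And>k. log_ratio x x2 w k \<le> 1" "\<And>k. log_ratio y y2 w' k \<le> 1"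
    unfolding mem_fst_Gamma_bar_iff by blast
  have cvx: "exp (a * p + b * q) \<le> a * exp p + b * exp q" for p q :: real
  proof -
    have a: "a = 1 - b" using ab by simp
    show ?thesis using convex_onD[OF exp_convex, of b p q] ab unfolding a by simp
  qed
  have "log_ratio (a * x + b * y) (a * x2 + b * y2) (\<lambda>l. a * w l + b * w' l) k
      \<le> a * log_ratio x x2 w k + b * log_ratio y y2 w' k" for k
  proof -
    have "exp (of_int i * (a * x + b * y) + of_int j * (a * x2 + b * y2)
        + (a * w l + b * w' l) - (a * w k + b * w' k))
      \<le> a * exp (of_int i * x + of_int j * x2 + w l - w k)
        + b * exp (of_int i * y + of_int j * y2 + w' l - w' k)" for i j l
      using cvx[of "of_int i * x + of_int j * x2 + w l - w k"
          "of_int i * y + of_int j * y2 + w' l - w' k"]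
      by (simp add: algebra_simps)
    then have "log_ratio (a * x + b * y) (a * x2 + b * y2) (\<lambda>l. a * w l + b * w' l) k
      \<le> (\<Sum>l\<in>UNIV. \<Sum>i\<in>HH. \<Sum>j\<in>HH. A i j $ k $ l *
          (a * exp (of_int i * x + of_int j * x2 + w l - w k)
          + b * exp (of_int i * y + of_int j * y2 + w' l - w' k)))"
      unfolding log_ratio_def by (intro sum_mono mult_left_mono nonneg)
    also have "\<dots> = a * log_ratio x x2 w k + b * log_ratio y y2 w' k"
      by (simp add: log_ratio_def sum_distrib_left sum.distrib algebra_simps)
    finally show ?thesis .
  qed
  also have "a * log_ratio x x2 w k + b * log_ratio y y2 w' k \<le> a * 1 + b * 1" for k
    by (intro add_mono mult_left_mono w ab)
  finally have "log_ratio (a * x + b * y) (a * x2 + b * y2) (\<lambda>l. a * w l + b * w' l) k \<le> 1" for k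
    using ab by simp
  then show "a *\<^sub>R x + b *\<^sub>R y \<in> fst ` Gamma_bar A"
    unfolding mem_fst_Gamma_bar_iff by auto
qed

text \<open>The projection is a compact interval, so it contains its infimum, its supremum and
  everything between them.\<close>

lemma exists_positive_supersol:
  assumes "z1_lo A \<le> x" "x \<le> z1_hi A"
  obtains s2 v where "supersol A (ln x) s2 v" "\<And>k. 0 < v $ k"
proof -
  let ?P = "fst ` Gamma_bar A"
  have ne: "?P \<noteq> {}" using zero_in_Gamma_bar by blast
  have bdd: "bdd_below ?P" "bdd_above ?P"
    by (simp_all add: compact_fst_Gamma_bar compact_imp_bounded bounded_imp_bdd_below bounded_imp_bdd_above)
  have cl: "closed ?P" using compact_fst_Gamma_bar by (rule compact_imp_closed)
  have "Inf ?P \<in> ?P" "Sup ?P \<in> ?P"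
    using closed_contains_Inf[OF ne bdd(1) cl] closed_contains_Sup[OF ne bdd(2) cl] .
  moreover have "is_interval ?P"
    using convex_fst_Gamma_bar by (simp add: is_interval_convex_1)
  moreover have "0 < x" using assms(1) unfolding z1_lo_def by (rule order_less_le_trans[OF exp_gt_zero])
  then have "Inf ?P \<le> ln x" "ln x \<le> Sup ?P"
    using assms exp_ln[of x] unfolding z1_lo_def z1_hi_def by (metis exp_le_cancel_iff)+
  ultimately have "ln x \<in> ?P"
    unfolding is_interval_1 by blast
  then obtain s2 v where "v \<in> prob_simplex" "supersol A (ln x) s2 v"
    using Gamma_bar_iff by force
  then show ?thesis using that supersol_pos by blast
qed

end

section \<open>Excursions and first passages\<close>

text \<open>The argument \<open>a\<close> is the current level, so that the recursion follows the
  path step by step; the start and end levels are tested too.\<close>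

primrec stays_nonneg :: "int \<Rightarrow> int list \<Rightarrow> bool" where
  "stays_nonneg a [] \<longleftrightarrow> 0 \<le> a"
| "stays_nonneg a (i # xs) \<longleftrightarrow> 0 \<le> a \<and> stays_nonneg (a + i) xs"

text \<open>Level -1 is reached at the last step and not before; from -1 itself only the empty path
  qualifies.\<close>

primrec passes_at_end :: "int \<Rightarrow> int list \<Rightarrow> bool" where
  "passes_at_end a [] \<longleftrightarrow> a = -1"
| "passes_at_end a (i # xs) \<longleftrightarrow> 0 \<le> a \<and> passes_at_end (a + i) xs"

definition excursions :: "int list set" where
  "excursions = {xs. set xs \<subseteq> HH \<and> stays_nonneg 0 xs \<and> sum_list xs = 0}"

definition first_passages :: "int \<Rightarrow> int list set" where
  "first_passages a = {xs. set xs \<subseteq> HH \<and> passes_at_end a xs}"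

lemma stays_nonneg_start: "stays_nonneg a xs \<Longrightarrow> 0 \<le> a"
  by (cases xs) auto

lemma stays_nonneg_iff: "stays_nonneg a xs \<longleftrightarrow> (\<forall>k. 0 \<le> a + sum_list (take k xs))"
proof (induction xs arbitrary: a)
  case (Cons i xs)
  have "(\<forall>k. 0 \<le> a + sum_list (take k (i # xs))) \<longleftrightarrow>
    0 \<le> a \<and> (\<forall>k. 0 \<le> a + i + sum_list (take k xs))" (is "?l \<longleftrightarrow> ?r")
  proof
    assume l: ?l
    show ?r using l[rule_format, of 0] l[rule_format, of "Suc _"] by (simp add: add.assoc)
  next
    assume r: ?r
    show ?l
    proof
      show "0 \<le> a + sum_list (take k (i # xs))" for k
        using r by (cases k) (auto simp: add.assoc)
    qed
  qed
  then show ?case using Cons.IH by simp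
qed simp

lemma stays_nonneg_append:
  "stays_nonneg a (xs @ ys) \<longleftrightarrow> stays_nonneg a xs \<and> stays_nonneg (a + sum_list xs) ys"
  by (induction xs arbitrary: a) (auto simp: add.assoc dest: stays_nonneg_start)

lemma passes_at_end_append:
  "stays_nonneg a xs \<Longrightarrow> passes_at_end (a + sum_list xs) ys \<Longrightarrow> passes_at_end a (xs @ ys)"
  by (induction xs arbitrary: a) (auto simp: add.assoc)

lemma excursion_append_first_passage:
  "xs \<in> excursions \<Longrightarrow> ys \<in> first_passages 0 \<Longrightarrow> xs @ ys \<in> first_passages 0"
  using passes_at_end_append[of 0 xs ys] by (auto simp: excursions_def first_passages_def)

text \<open>Paths go down by at most 1 per step, so they can leave the nonnegative levels only
  through a step -1 taken at level 0.\<close>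

lemma first_descent:
  assumes "set zs \<subseteq> HH" "0 \<le> a" "a + sum_list zs < 0"
  shows "\<exists>xs ys. zs = xs @ (-1) # ys \<and> stays_nonneg a xs \<and> a + sum_list xs = 0"
  using assms
proof (induction zs arbitrary: a)
  case (Cons i zs)
  show ?case
  proof (cases "0 \<le> a + i")
    case True
    then obtain xs ys where "zs = xs @ (-1) # ys" "stays_nonneg (a + i) xs" "a + i + sum_list xs = 0"
      using Cons.IH[of "a + i"] Cons.prems by (auto simp: add.assoc)
    then show ?thesis using Cons.prems
      by (intro exI[of _ "i # xs"] exI[of _ ys]) auto
  next
    case False
    then have "i = -1" "a = 0" using Cons.prems by (auto simp: HH_def)
    then show ?thesis by (intro exI[of _ "[]"] exI[of _ zs]) auto
  qed
qed simp

text \<open>If one excursion were shorter, the longer one would start with it followed by -1, and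
  would thus visit level -1.\<close>

lemma first_descent_unique:
  assumes "xs @ (-1) # ys = xs' @ (-1) # ys'" and "xs \<in> excursions" "xs' \<in> excursions"
  shows "xs = xs' \<and> ys = ys'"
proof -
  have not_less: "\<not> length us < length us'"
    if eq: "us @ (-1) # vs = us' @ (-1) # vs'" and us: "us \<in> excursions" "us' \<in> excursions"
    for us us' vs vs' :: "int list"
  proof
    assume less: "length us < length us'"
    have "take (Suc (length us)) us' = take (Suc (length us)) (us' @ (-1) # vs')"
      using less by simp
    also have "\<dots> = us @ [-1]" by (simp flip: eq)
    finally have "sum_list (take (Suc (length us)) us') = -1"
      using us(1) by (simp add: excursions_def)
    moreover have "0 \<le> sum_list (take (Suc (length us)) us')"
      using us(2) by (simp add: excursions_def stays_nonneg_iff)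
    ultimately show False by simp
  qed
  have "length xs = length xs'"
    using not_less[OF assms] not_less[OF assms(1)[symmetric] assms(3,2)] by simp
  then show ?thesis using assms(1) by simp
qed

lemma Nil_excursion: "[] \<in> excursions"
  by (simp add: excursions_def)

lemma Cons_0_excursion_iff: "0 # xs \<in> excursions \<longleftrightarrow> xs \<in> excursions"
  by (auto simp: excursions_def HH_def)

lemma excursion_up_down:
  assumes "xs \<in> excursions" "ys \<in> excursions"
  shows "1 # xs @ (-1) # ys \<in> excursions"
proof -
  have "stays_nonneg 1 xs"
    using assms(1) by (force simp: excursions_def stays_nonneg_iff)
  then show ?thesis
    using assms by (auto simp: excursions_def stays_nonneg_append HH_def)
qed

lemma excursions_decomp:
  "excursions = insert [] ((#) 0 ` excursions \<union>
    (\<lambda>(xs, ys). 1 # xs @ (-1) # ys) ` (excursions \<times> excursions))" (is "_ = ?R")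
proof
  show "?R \<subseteq> excursions"
    by (auto simp: Nil_excursion Cons_0_excursion_iff excursion_up_down)
  show "excursions \<subseteq> ?R"
  proof
    fix zs assume zs: "zs \<in> excursions"
    show "zs \<in> ?R"
    proof (cases zs)
      case (Cons i us)
      then have us: "set us \<subseteq> HH" "stays_nonneg i us" "i + sum_list us = 0" "i \<in> HH"
        using zs by (auto simp: excursions_def)
      have "0 \<le> i" using us(2) by (rule stays_nonneg_start)
      then consider "i = 0" | "i = 1" using us(4) by (auto simp: HH_def)
      then show ?thesis
      proof cases
        case 1
        then show ?thesis using zs Cons by (auto simp: Cons_0_excursion_iff)
      next
        case 2
        \<comment> \<open>Levels are counted from 1 here: after the step up, the return to level 0
          is the first descent below the new origin.\<close>
        then obtain xs ys where d: "us = xs @ (-1) # ys" "stays_nonneg 0 xs" "sum_list xs = 0"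
          using first_descent[of us 0] us by auto
        then have "xs \<in> excursions" "ys \<in> excursions"
          using us 2 by (auto simp: excursions_def stays_nonneg_append)
        then show ?thesis using d(1) Cons 2 by auto
      qed
    qed simp
  qed
qed

lemma inj_up_down: "inj_on (\<lambda>(xs, ys). 1 # xs @ (-1) # ys) (excursions \<times> excursions)"
proof (rule inj_onI)
  fix p q
  assume p: "p \<in> excursions \<times> excursions" and q: "q \<in> excursions \<times> excursions"
    and eq: "(\<lambda>(xs, ys). 1 # xs @ (-1) # ys) p = (\<lambda>(xs, ys). 1 # xs @ (-1) # ys) q"
  show "p = q"
    using first_descent_unique[of "fst p" "snd p" "fst q" "snd q"] p q eq
    by (simp add: mem_Times_iff prod_eq_iff split_beta)
qed

section \<open>The index sets of the path sums in terms of excursions\<close>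

lemma I_set_eq: "I_set n = {xs \<in> excursions. length xs = n}"
proof -
  have "(\<forall>k\<in>{1..n - 1}. 0 \<le> sum_list (take k xs)) \<longleftrightarrow> stays_nonneg 0 xs"
    if "length xs = n" "sum_list xs = 0" for xs :: "int list"
    unfolding stays_nonneg_iff
  proof safe
    fix k assume h: "\<forall>k\<in>{1..n - 1}. 0 \<le> sum_list (take k xs)"
    show "0 \<le> 0 + sum_list (take k xs)"
      \<comment> \<open>The prefixes outside the range 1, ..., n - 1 are the empty and the full
        list, both of sum 0.\<close>
      using h that by (cases "k = 0 \<or> n \<le> k") auto
  qed auto
  then show ?thesis by (auto simp: I_set_def excursions_def)
qed

lemma finite_I_set: "finite (I_set n)"
proof (rule finite_subset)
  show "I_set n \<subseteq> {xs. set xs \<subseteq> HH \<and> length xs = n}" by (auto simp: I_set_def)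
  show "finite {xs. set xs \<subseteq> HH \<and> length xs = n}" by (rule finite_lists_length_eq) simp
qed

lemma I_D_set_Suc: "I_D_set (Suc n) = (\<lambda>xs. xs @ [-1]) ` I_set n"
proof
  show "I_D_set (Suc n) \<subseteq> (\<lambda>xs. xs @ [-1]) ` I_set n"
  proof
    fix zs assume zs: "zs \<in> I_D_set (Suc n)"
    then obtain xs i where eq: "zs = xs @ [i]"
      by (cases zs rule: rev_exhaust) (auto simp: I_D_set_def)
    have n: "length xs = n" and h: "\<And>k. k \<in> {1..n} \<Longrightarrow> 0 \<le> sum_list (take k xs)"
      and s: "sum_list xs + i = -1" and HH: "set xs \<subseteq> HH" "i \<in> HH"
      using zs by (auto simp: I_D_set_def eq)
    \<comment> \<open>Before the last step the level is nonnegative, so the total -1 forces that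
      step down. For n = 0 the range of \<open>h\<close> is empty, but then \<open>xs\<close> is
      too.\<close>
    have "0 \<le> sum_list xs" using h[of n] n by (cases "n = 0") auto
    then have i: "i = -1" and "sum_list xs = 0" using s HH(2) by (auto simp: HH_def)
    then have "xs \<in> I_set n" using n h HH by (auto simp: I_set_def)
    then show "zs \<in> (\<lambda>xs. xs @ [-1]) ` I_set n" by (simp add: eq i)
  qed
  show "(\<lambda>xs. xs @ [-1]) ` I_set n \<subseteq> I_D_set (Suc n)"
  proof safe
    fix xs assume "xs \<in> I_set n"
    then have "xs \<in> excursions" "length xs = n" by (auto simp: I_set_eq)
    then show "xs @ [-1] \<in> I_D_set (Suc n)"
      by (auto simp: I_D_set_def excursions_def stays_nonneg_iff HH_def)
  qed
qed

lemma I_U_set_Suc: "I_U_set (Suc n) = (#) 1 ` I_set n"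
proof
  show "I_U_set (Suc n) \<subseteq> (#) 1 ` I_set n"
  proof
    fix zs assume zs: "zs \<in> I_U_set (Suc n)"
    then obtain xs i where eq: "zs = i # xs"
      by (cases zs) (auto simp: I_U_set_def)
    have n: "length xs = n" and h: "\<And>k. k \<in> {1..n} \<Longrightarrow> 1 \<le> sum_list (take k (i # xs))"
      and s: "i + sum_list xs = 1" and HH: "set xs \<subseteq> HH" "i \<in> HH"
      using zs by (auto simp: I_U_set_def eq)
    \<comment> \<open>The prefix of length 1 forces the first step up; for n = 0 the total
      does.\<close>
    have "1 \<le> i" using h[of 1] n s by (cases "n = 0") auto
    then have i: "i = 1" using HH(2) by (auto simp: HH_def)
    then have "0 \<le> sum_list (take k xs)" if "k \<in> {1..n - 1}" for k
      using h[of "Suc k"] that by auto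
    then show "zs \<in> (#) 1 ` I_set n"
      using n s HH i by (auto simp: eq I_set_def)
  qed
  show "(#) 1 ` I_set n \<subseteq> I_U_set (Suc n)"
  proof safe
    fix xs assume "xs \<in> I_set n"
    then have xs: "xs \<in> excursions" "length xs = n" by (auto simp: I_set_eq)
    have "1 \<le> sum_list (take k (1 # xs))" if "1 \<le> k" for k
      using xs(1) that by (cases k) (auto simp: excursions_def stays_nonneg_iff)
    then show "1 # xs \<in> I_U_set (Suc n)"
      using xs by (auto simp: I_U_set_def excursions_def HH_def)
  qed
qed

section \<open>Unordered sums: bilinear products and grouping\<close>

lemma has_sum_bounded_bilinear:
  fixes B :: "'a::banach \<Rightarrow> 'b::banach \<Rightarrow> 'c::banach"
  assumes B: "bounded_bilinear B" and f: "(\<lambda>x. norm (f x)) summable_on X"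
    and g: "(\<lambda>y. norm (g y)) summable_on Y"
  shows "((\<lambda>(x, y). B (f x) (g y)) has_sum B (infsum f X) (infsum g Y)) (X \<times> Y)"
proof (rule has_sum_SigmaI)
  interpret bounded_bilinear B by (rule B)
  have sf: "(f has_sum infsum f X) X" and sg: "(g has_sum infsum g Y) Y"
    using f g by (simp_all add: abs_summable_summable)
  show "((\<lambda>y. (\<lambda>(x, y). B (f x) (g y)) (x, y)) has_sum B (f x) (infsum g Y)) Y" for x
    using has_sum_bounded_linear[OF bounded_linear_right sg, of "f x"] by simp
  show "((\<lambda>x. B (f x) (infsum g Y)) has_sum B (infsum f X) (infsum g Y)) X"
    using has_sum_bounded_linear[OF bounded_linear_left sf] .
  \<comment> \<open>The iterated sums already have the right value; joint summability comes from
    comparison with the product of the two norm families.\<close>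
  obtain K where K: "\<And>a b. norm (B a b) \<le> norm a * norm b * K"
    using bounded by blast
  have "(\<lambda>p. norm (norm (f (fst p)) * norm (g (snd p)))) summable_on X \<times> Y"
    unfolding Infinite_Sum.abs_summable_on_Sigma_iff using f g
    by (auto simp: abs_mult infsum_cmult_right' intro: summable_on_cmult_left summable_on_cmult_right)
  then have "(\<lambda>p. norm (f (fst p)) * norm (g (snd p)) * K) summable_on X \<times> Y"
    by (intro summable_on_cmult_left) (simp add: abs_mult)
  then have "(\<lambda>p. norm (case p of (x, y) \<Rightarrow> B (f x) (g y))) summable_on X \<times> Y"
    by (rule Infinite_Sum.abs_summable_on_comparison_test') (use K in auto)
  then show "(\<lambda>(x, y). B (f x) (g y)) summable_on X \<times> Y"
    by (rule abs_summable_summable)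
qed

text \<open>Used with r = \<open>length\<close>, to turn a sum over all paths into the series over
  n.\<close>

lemma has_sum_sums_fibres:
  fixes f :: "'a \<Rightarrow> 'b::banach"
  assumes sum: "(f has_sum S) X" and fin: "\<And>n. finite {x \<in> X. r x = n}"
  shows "(\<lambda>n::nat. \<Sum>x | x \<in> X \<and> r x = n. f x) sums S"
proof -
  have "((\<lambda>(n, x). f x) has_sum S) (SIGMA n:UNIV. {x \<in> X. r x = n})"
    using sum by (subst has_sum_reindex_bij_witness[of _ "\<lambda>x. (r x, x)" snd X f _ S]) auto
  then have "((\<lambda>n. \<Sum>x | x \<in> X \<and> r x = n. f x) has_sum S) UNIV"
    by (rule has_sum_SigmaD) (use fin in \<open>simp add: has_sum_finite\<close>)
  then show ?thesis by (rule has_sum_imp_sums)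
qed

lemma bounded_bilinear_matrix_mult:
  "bounded_bilinear ((**) :: complex^'s::finite^'s \<Rightarrow> complex^'s^'s \<Rightarrow> complex^'s^'s)"
proof -
  have "bilinear ((**) :: complex^'s^'s \<Rightarrow> complex^'s^'s \<Rightarrow> complex^'s^'s)"
    unfolding bilinear_def
  proof (intro conjI allI linearI)
    fix X Y Z :: "complex^'s^'s"
    show "(Y + Z) ** X = Y ** X + Z ** X"
      by (simp add: matrix_matrix_mult_def vec_eq_iff sum.distrib distrib_right)
  qed (simp_all add: matrix_add_ldistrib matrix_scalar_ac scalar_matrix_assoc)
  then show ?thesis by (simp add: bilinear_conv_bounded_bilinear)
qed

section \<open>Summability of path products\<close>

definition real_A_star :: "'s::finite blocks \<Rightarrow> int \<Rightarrow> real \<Rightarrow> real^'s^'s" where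
  "real_A_star A j x = (\<chi> k l. \<Sum>i\<in>HH. A i j $ k $ l * x powi i)"

definition real_path_prod :: "'s::finite blocks \<Rightarrow> real \<Rightarrow> int list \<Rightarrow> real^'s^'s" where
  "real_path_prod A x xs = foldr (\<lambda>i M. real_A_star A i x ** M) xs (mat 1)"

lemma path_prod_simps [simp]:
  "path_prod A z [] = mat 1" "path_prod A z (i # xs) = A_star A i z ** path_prod A z xs"
  by (simp_all add: path_prod_def)

lemma real_path_prod_simps [simp]:
  "real_path_prod A x [] = mat 1"
  "real_path_prod A x (i # xs) = real_A_star A i x ** real_path_prod A x xs"
  by (simp_all add: real_path_prod_def)

lemma path_prod_append: "path_prod A z (xs @ ys) = path_prod A z xs ** path_prod A z ys"
  by (induction xs) (simp_all add: matrix_mul_assoc)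

lemma real_path_prod_append:
  "real_path_prod A x (xs @ ys) = real_path_prod A x xs ** real_path_prod A x ys"
  by (induction xs) (simp_all add: matrix_mul_assoc)

lemma cmat_mult: "cmat (X ** Y) = cmat X ** cmat (Y :: real^'s::finite^'s)"
  by (simp add: cmat_def matrix_matrix_mult_def vec_eq_iff)

lemma cmat_mat_1: "cmat (mat 1) = mat 1"
  by (simp add: cmat_def mat_def vec_eq_iff)

lemma A_star_of_real: "A_star A j (complex_of_real x) = cmat (real_A_star A j x)"
  by (simp add: A_star_def real_A_star_def cmat_def)

lemma path_prod_of_real: "path_prod A (complex_of_real x) xs = cmat (real_path_prod A x xs)"
  by (induction xs) (simp_all add: cmat_mult cmat_mat_1 A_star_of_real)

text \<open>As \<open>Q11 A 0\<close> is the unit matrix and \<open>I_set 0 = {[]}\<close>, the case \<open>n = 0\<close> is no exception.\<close>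

lemma Q11_eq: "Q11 A n z = (\<Sum>xs\<in>I_set n. path_prod A z xs)"
proof (cases "n = 0")
  case True
  have "I_set 0 = {[]}" by (auto simp: I_set_def)
  then show ?thesis using True by (simp add: Q11_def)
qed (simp add: Q11_def)

lemma D1_Suc: "D1 A (Suc n) z = Q11 A n z ** A_star A (-1) z"
proof -
  interpret bounded_bilinear "(**) :: complex^'s^'s \<Rightarrow> complex^'s^'s \<Rightarrow> complex^'s^'s"
    by (rule bounded_bilinear_matrix_mult)
  have "D1 A (Suc n) z = (\<Sum>xs\<in>I_set n. path_prod A z xs ** A_star A (-1) z)"
    unfolding D1_def I_D_set_Suc
    by (subst sum.reindex) (auto simp: inj_on_def path_prod_append)
  then show ?thesis by (simp add: Q11_eq sum_left)
qed

lemma U1_Suc: "U1 A (Suc n) z = A_star A 1 z ** Q11 A n z"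
proof -
  interpret bounded_bilinear "(**) :: complex^'s^'s \<Rightarrow> complex^'s^'s \<Rightarrow> complex^'s^'s"
    by (rule bounded_bilinear_matrix_mult)
  have "U1 A (Suc n) z = (\<Sum>xs\<in>I_set n. A_star A 1 z ** path_prod A z xs)"
    unfolding U1_def I_U_set_Suc by (subst sum.reindex) auto
  then show ?thesis by (simp add: Q11_eq sum_right)
qed

lemma norm_matrix_le: "norm (X :: complex^'s::finite^'s) \<le> (\<Sum>k\<in>UNIV. \<Sum>l\<in>UNIV. cmod (X $ k $ l))"
proof -
  have "norm X \<le> (\<Sum>k\<in>UNIV. norm (X $ k))"
    unfolding norm_vec_def by (rule L2_set_le_sum) simp
  also have "\<dots> \<le> (\<Sum>k\<in>UNIV. \<Sum>l\<in>UNIV. cmod (X $ k $ l))"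
    unfolding norm_vec_def[where 'a=complex] by (intro sum_mono L2_set_le_sum) simp
  finally show ?thesis .
qed

lemma cmod_entry_le_norm: "cmod (X $ k $ l) \<le> norm (X :: complex^'s::finite^'s)"
  by (meson Finite_Cartesian_Product.norm_nth_le order_trans)

lemma abs_summable_matI:
  assumes "summable (\<lambda>n. norm (F n))"
  shows "abs_summable_mat F"
  unfolding abs_summable_mat_def
  by (intro allI summable_comparison_test'[OF assms, of 0]) (simp add: cmod_entry_le_norm)

lemma mat_abs_mult_le:
  assumes "mat_le (mat_abs X) X'" "mat_le (mat_abs Y) Y'"
  shows "mat_le (mat_abs (X ** Y)) (X' ** Y')"
proof -
  have X: "complex_of_real (cmod (X $ k $ l)) \<le> X' $ k $ l" for k l
    using assms(1) by (simp add: mat_le_def mat_abs_def)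
  have Y: "complex_of_real (cmod (Y $ k $ l)) \<le> Y' $ k $ l" for k l
    using assms(2) by (simp add: mat_le_def mat_abs_def)
  have "complex_of_real (cmod ((X ** Y) $ k $ l)) \<le> (X' ** Y') $ k $ l" for k l
  proof -
    have "cmod ((X ** Y) $ k $ l) \<le> (\<Sum>m\<in>UNIV. cmod (X $ k $ m) * cmod (Y $ m $ l))"
      unfolding matrix_matrix_mult_def by (simp add: norm_mult[symmetric] norm_sum)
    then have "complex_of_real (cmod ((X ** Y) $ k $ l))
        \<le> (\<Sum>m\<in>UNIV. complex_of_real (cmod (X $ k $ m)) * complex_of_real (cmod (Y $ m $ l)))"
      by (simp add: less_eq_complex_def)
    also have "\<dots> \<le> (\<Sum>m\<in>UNIV. X' $ k $ m * Y' $ m $ l)"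
      \<comment> \<open>\<open>mult_mono\<close> needs 0 \<le> \<open>X' $ k $ m\<close>, which
        holds because this entry lies above a modulus.\<close>
      by (intro sum_mono mult_mono X Y order_trans[OF _ X]) (simp_all add: less_eq_complex_def)
    finally show ?thesis by (simp add: matrix_matrix_mult_def)
  qed
  then show ?thesis by (simp add: mat_le_def mat_abs_def)
qed

context irreducible_blocks
begin

lemma real_A_star_nonneg: "j \<in> HH \<Longrightarrow> 0 < x \<Longrightarrow> 0 \<le> real_A_star A j x $ k $ l"
  by (auto simp: real_A_star_def intro!: sum_nonneg mult_nonneg_nonneg nonneg)

lemma real_path_prod_nonneg:
  "set xs \<subseteq> HH \<Longrightarrow> 0 < x \<Longrightarrow> 0 \<le> real_path_prod A x xs $ k $ l"
proof (induction xs arbitrary: k)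
  case Nil
  then show ?case by (simp add: mat_def)
next
  case (Cons i xs)
  then show ?case
    by (auto simp: matrix_matrix_mult_def intro!: sum_nonneg mult_nonneg_nonneg real_A_star_nonneg)
qed

lemma real_path_prod_mult_ge:
  assumes "set xs \<subseteq> HH" "set ys \<subseteq> HH" "0 < x"
  shows "real_path_prod A x xs $ k $ m * real_path_prod A x ys $ m $ l
    \<le> real_path_prod A x (xs @ ys) $ k $ l"
  unfolding real_path_prod_append matrix_matrix_mult_def using assms
  by (simp, intro member_le_sum) (auto intro!: mult_nonneg_nonneg real_path_prod_nonneg)

lemma A_star_le: "j \<in> HH \<Longrightarrow> cmod (A_star A j z $ k $ l) \<le> real_A_star A j (cmod z) $ k $ l"
  unfolding A_star_def real_A_star_def
  by (simp, intro sum_norm_le) (simp add: norm_mult norm_power_int nonneg)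

lemma path_prod_le:
  "set xs \<subseteq> HH \<Longrightarrow> cmod (path_prod A z xs $ k $ l) \<le> real_path_prod A (cmod z) xs $ k $ l"
proof (induction xs arbitrary: k)
  case Nil
  then show ?case by (simp add: mat_def)
next
  case (Cons i xs)
  have "cmod (A_star A i z $ k $ m * path_prod A z xs $ m $ l)
    \<le> real_A_star A i (cmod z) $ k $ m * real_path_prod A (cmod z) xs $ m $ l" for m
    unfolding norm_mult using Cons
    by (intro mult_mono) (auto intro: A_star_le order_trans[OF norm_ge_zero A_star_le])
  then show ?case
    by (simp add: matrix_matrix_mult_def sum_norm_le)
qed

lemma exp_C_eq_sum_real_A_star:
  assumes "0 < x"
  shows "exp_C A (ln x) s2 $ k $ l = (\<Sum>j\<in>HH. real_A_star A j x $ k $ l * exp (of_int j * s2))"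
proof -
  have "exp (of_int i * ln x) = x powi i" for i
    using assms exp_power_int[of "ln x" i] by simp
  then have "exp_C A (ln x) s2 $ k $ l
      = (\<Sum>i\<in>HH. \<Sum>j\<in>HH. A i j $ k $ l * x powi i * exp (of_int j * s2))"
    by (simp add: exp_C_def exp_add mult.assoc)
  also have "\<dots> = (\<Sum>j\<in>HH. \<Sum>i\<in>HH. A i j $ k $ l * x powi i * exp (of_int j * s2))"
    by (rule sum.swap)
  finally show ?thesis by (simp add: real_A_star_def sum_distrib_right)
qed

text \<open>A supersolution bounds the expected payoff \<open>v\<close> at the first passage below level 0, by
  induction on the length of the paths.\<close>

lemma first_passage_bound:
  assumes x: "0 < x" and v: "supersol A (ln x) s2 v"
    and X: "finite X" "X \<subseteq> first_passages a" "-1 \<le> a"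
  shows "(\<Sum>xs\<in>X. (real_path_prod A x xs *v v) $ k) \<le> exp (of_int (a + 1) * s2) * v $ k"
proof -
  have v0: "0 \<le> v $ i" for i using v by (simp add: supersol_def)
  \<comment> \<open>The function exp (a * s2) * v_k of level a and phase k is superharmonic for the
    step weights; \<open>a + 1\<close> is the height above the exit level -1. The induction on a
    length bound n leaves level, phase and path set free, since the first step changes all of
    them.\<close>
  have "(\<Sum>xs\<in>X. (real_path_prod A x xs *v v) $ k) \<le> exp (of_int (a + 1) * s2) * v $ k"
    if "finite X" "X \<subseteq> first_passages a" "-1 \<le> a" "\<forall>xs\<in>X. length xs < n" for n
    using that
  proof (induction n arbitrary: a X k)
    case 0
    then show ?case using v0 by auto
  next
    case (Suc n)
    show ?case
    proof (cases "a = -1")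
      case True
      have "xs = []" if "xs \<in> X" for xs
        using that Suc.prems(2) True by (cases xs) (auto simp: first_passages_def)
      then have "X = {} \<or> X = {[]}" by blast
      then show ?thesis using True v0 by auto
    next
      case False
      then have a: "0 \<le> a" using Suc.prems(3) by simp
      \<comment> \<open>The tails of the paths in \<open>X\<close> that start with the step
        \<open>i\<close>; they are first passages from \<open>a + i\<close>.\<close>
      define Y where "Y i = {xs. i # xs \<in> X}" for i
      have finY: "finite (Y i)" for i
        unfolding Y_def using finite_vimageI[OF Suc.prems(1), of "(#) i"] by (simp add: vimage_def)
      have "zs \<in> (\<Union>i\<in>HH. (#) i ` Y i)" if "zs \<in> X" for zs
      proof -
        have "zs \<in> first_passages a" using that Suc.prems(2) by blast
        then show ?thesis using that a by (cases zs) (auto simp: first_passages_def Y_def)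
      qed
      then have X_eq: "X = (\<Union>i\<in>HH. (#) i ` Y i)" by (auto simp: Y_def)
      have IH: "(\<Sum>xs\<in>Y i. (real_path_prod A x xs *v v) $ m) \<le> exp (of_int (a + i + 1) * s2) * v $ m"
        if "i \<in> HH" for i m
      proof (rule Suc.IH)
        show "Y i \<subseteq> first_passages (a + i)"
        proof
          fix xs assume "xs \<in> Y i"
          then have "i # xs \<in> first_passages a" using Suc.prems(2) by (auto simp: Y_def)
          then show "xs \<in> first_passages (a + i)" by (simp add: first_passages_def)
        qed
        show "-1 \<le> a + i" using a that by (auto simp: HH_def)
        show "\<forall>xs\<in>Y i. length xs < n" using Suc.prems(4) by (auto simp: Y_def)
      qed (rule finY)
      have "(\<Sum>xs\<in>X. (real_path_prod A x xs *v v) $ k)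
          = (\<Sum>i\<in>HH. \<Sum>xs\<in>(#) i ` Y i. (real_path_prod A x xs *v v) $ k)"
        by (subst X_eq, rule sum.UNION_disjoint) (auto simp: finY)
      also have "\<dots> = (\<Sum>i\<in>HH. \<Sum>xs\<in>Y i. \<Sum>m\<in>UNIV.
          real_A_star A i x $ k $ m * (real_path_prod A x xs *v v) $ m)"
        by (rule sum.cong[OF refl], subst sum.reindex)
          (simp_all add: matrix_vector_mul_assoc[symmetric] matrix_vector_mult_def[of "real_A_star _ _ _"])
      also have "\<dots> = (\<Sum>i\<in>HH. \<Sum>m\<in>UNIV.
          real_A_star A i x $ k $ m * (\<Sum>xs\<in>Y i. (real_path_prod A x xs *v v) $ m))"
        by (rule sum.cong[OF refl], subst sum.swap) (simp add: sum_distrib_left)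
      also have "\<dots> \<le> (\<Sum>i\<in>HH. \<Sum>m\<in>UNIV.
          real_A_star A i x $ k $ m * (exp (of_int (a + i + 1) * s2) * v $ m))"
        by (intro sum_mono mult_left_mono IH real_A_star_nonneg x)
      also have "\<dots> = (\<Sum>m\<in>UNIV. \<Sum>i\<in>HH.
          real_A_star A i x $ k $ m * (exp (of_int (a + i + 1) * s2) * v $ m))"
        by (rule sum.swap)
      \<comment> \<open>Taking out the factor of the starting level leaves the weights exp (i * s2),
        which together with the step matrices make up \<open>exp_C\<close>.\<close>
      also have "\<dots> = exp (of_int (a + 1) * s2) * (exp_C A (ln x) s2 *v v) $ k"
      proof -
        have "exp (of_int (a + i + 1) * s2) = exp (of_int (a + 1) * s2) * exp (of_int i * s2)" for i
          by (simp add: algebra_simps flip: exp_add)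
        then show ?thesis
          by (simp add: matrix_vector_mult_def exp_C_eq_sum_real_A_star[OF x] sum_distrib_left
            sum_distrib_right mult_ac)
      qed
      also have "\<dots> \<le> exp (of_int (a + 1) * s2) * v $ k"
        using v by (intro mult_left_mono) (auto simp: supersol_def)
      finally show ?thesis .
    qed
  qed
  moreover have "\<forall>xs\<in>X. length xs < Suc (Max (length ` X))"
    using X(1) by (auto simp: less_Suc_eq_le)
  ultimately show ?thesis using X by blast
qed

lemma summable_on_first_passages:
  assumes x: "0 < x" and v: "supersol A (ln x) s2 v" "\<And>k. 0 < v $ k"
  shows "(\<lambda>xs. real_path_prod A x xs $ k $ l) summable_on first_passages 0"
proof (rule nonneg_bdd_above_summable_on)
  have nn: "0 \<le> real_path_prod A x xs $ i $ j" if "xs \<in> first_passages 0" for xs i j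
    using that x by (intro real_path_prod_nonneg) (auto simp: first_passages_def)
  then show "0 \<le> real_path_prod A x xs $ k $ l" if "xs \<in> first_passages 0" for xs
    using that .
  show "bdd_above (sum (\<lambda>xs. real_path_prod A x xs $ k $ l) ` {F. F \<subseteq> first_passages 0 \<and> finite F})"
  proof (rule bdd_aboveI2)
    fix F assume "F \<in> {F. F \<subseteq> first_passages 0 \<and> finite F}"
    then have F: "F \<subseteq> first_passages 0" "finite F" by auto
    \<comment> \<open>An entry times v_l is one of the nonnegative terms of the payoff at
      \<open>k\<close>; dividing by v_l > 0 at the end bounds the entry itself.\<close>
    have "(\<Sum>xs\<in>F. real_path_prod A x xs $ k $ l) * v $ l
        = (\<Sum>xs\<in>F. real_path_prod A x xs $ k $ l * v $ l)"
      by (rule sum_distrib_right)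
    also have "\<dots> \<le> (\<Sum>xs\<in>F. (real_path_prod A x xs *v v) $ k)"
    proof (rule sum_mono)
      fix xs assume "xs \<in> F"
      then have "xs \<in> first_passages 0" using F by blast
      then show "real_path_prod A x xs $ k $ l * v $ l \<le> (real_path_prod A x xs *v v) $ k"
        unfolding matrix_vector_mult_def using nn v(2)
        by (simp, intro member_le_sum) (auto intro!: mult_nonneg_nonneg intro: less_imp_le)
    qed
    also have "\<dots> \<le> exp s2 * v $ k"
      using first_passage_bound[OF x v(1) F(2,1)] by simp
    finally show "(\<Sum>xs\<in>F. real_path_prod A x xs $ k $ l) \<le> exp s2 * v $ k / v $ l"
      using v(2)[of l] by (simp add: field_simps)
  qed
qed

text \<open>The path is cut at its first visit to -1, a level that cannot be jumped over. The phase
  there is beyond control, hence the existential \<open>m\<close>. The second coordinate of the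
  chain is the level; displacement in the first only contributes a positive power of x.\<close>

lemma first_passage_from_path:
  assumes "0 < n_step states0 (chain0 A) n (b, a, k) (b', a', l)" "-1 \<le> a" "a' < 0" "0 < x"
  shows "\<exists>xs\<in>first_passages a. \<exists>m. 0 < real_path_prod A x xs $ k $ m"
  using assms
proof (induction n arbitrary: b a k)
  case 0
  then have "a = -1" by (auto split: if_splits)
  then show ?case by (intro bexI[of _ "[]"] exI[of _ k]) (auto simp: first_passages_def mat_def)
next
  case (Suc n)
  show ?case
  proof (cases "a = -1")
    case True
    then show ?thesis by (intro bexI[of _ "[]"] exI[of _ k]) (auto simp: first_passages_def mat_def)
  next
    case False
    then have a: "0 \<le> a" using Suc.prems(2) by simp
    from n_step_SucD[OF chain0_nonneg Suc.prems(1)] obtain c d m where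
      u: "0 < chain0 A (b, a, k) (c, d, m)"
         "0 < n_step states0 (chain0 A) n (c, d, m) (b', a', l)"
      by (metis prod_cases3)
    note step = chain0_pos[OF u(1)]
    have "-1 \<le> d" using step(2) a by (auto simp: HH_def)
    from Suc.IH[OF u(2) this Suc.prems(3,4)] obtain xs m' where
      xs: "xs \<in> first_passages d" "0 < real_path_prod A x xs $ m $ m'" by blast
    have "0 < A (c - b) (d - a) $ k $ m * x powi (c - b)"
      using step(3) Suc.prems(4) by simp
    also have "\<dots> \<le> real_A_star A (d - a) x $ k $ m"
      unfolding real_A_star_def using step Suc.prems(4)
      by (simp, intro member_le_sum) (auto intro!: mult_nonneg_nonneg nonneg)
    finally have "0 < real_A_star A (d - a) x $ k $ m * real_path_prod A x xs $ m $ m'"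
      using xs(2) by simp
    also have "\<dots> \<le> real_path_prod A x ((d - a) # xs) $ k $ m'"
      using real_path_prod_mult_ge[of "[d - a]" xs x k m m'] step(2) xs(1) Suc.prems(4)
      by (simp add: first_passages_def)
    finally have "0 < real_path_prod A x ((d - a) # xs) $ k $ m'" .
    moreover have "(d - a) # xs \<in> first_passages a"
      using a step(2) xs(1) by (auto simp: first_passages_def)
    ultimately show ?thesis by blast
  qed
qed

text \<open>Appending a fixed first passage of positive weight maps excursions injectively to first
  passages.\<close>

lemma summable_on_excursions:
  assumes x: "0 < x" and v: "supersol A (ln x) s2 v" "\<And>k. 0 < v $ k"
  shows "(\<lambda>xs. real_path_prod A x xs $ k $ l) summable_on excursions"
proof -
  \<comment> \<open>The appended path must start in the phase \<open>l\<close> where the excursions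
    end.\<close>
  obtain n where "0 < n_step states0 (chain0 A) n (0, 0, l) (0, -1, l)"
    using reachable by blast
  then obtain ys m where ys: "ys \<in> first_passages 0" and p: "0 < real_path_prod A x ys $ l $ m"
    using first_passage_from_path[of n 0 0 l 0 "-1" l x] x by auto
  have inj: "inj_on (\<lambda>xs. xs @ ys) excursions" by (auto simp: inj_on_def)
  have "(\<lambda>xs. real_path_prod A x xs $ k $ m) summable_on (\<lambda>xs. xs @ ys) ` excursions"
    using summable_on_first_passages[OF x v]
    by (rule summable_on_subset_banach) (use ys in \<open>auto intro: excursion_append_first_passage\<close>)
  then have "(\<lambda>xs. real_path_prod A x (xs @ ys) $ k $ m) summable_on excursions"
    by (simp add: summable_on_reindex[OF inj] o_def)
  \<comment> \<open>The concatenation through phase \<open>l\<close> is one term of the full entry,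
    so dividing by the fixed weight of \<open>ys\<close> dominates the entry of the
    excursion.\<close>
  then have "(\<lambda>xs. real_path_prod A x (xs @ ys) $ k $ m * inverse (real_path_prod A x ys $ l $ m))
      summable_on excursions"
    by (rule summable_on_cmult_left)
  then show ?thesis
  proof (rule summable_on_comparison_test)
    fix xs assume "xs \<in> excursions"
    then have xs: "set xs \<subseteq> HH" by (simp add: excursions_def)
    then show "0 \<le> real_path_prod A x xs $ k $ l"
      using x by (rule real_path_prod_nonneg)
    show "real_path_prod A x xs $ k $ l 
      \<le> real_path_prod A x (xs @ ys) $ k $ m * inverse (real_path_prod A x ys $ l $ m)"
      using real_path_prod_mult_ge[OF xs _ x, of ys k l m] ys p
      by (simp add: first_passages_def field_simps)
  qed
qed

end

section \<open>The matrix equations\<close>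

lemma summable_on_sum:
  fixes f :: "'a \<Rightarrow> 'b \<Rightarrow> 'c::topological_comm_monoid_add"
  assumes "\<And>i. i \<in> I \<Longrightarrow> f i summable_on X"
  shows "(\<lambda>x. \<Sum>i\<in>I. f i x) summable_on X"
  using assms by (induction I rule: infinite_finite_induct) (auto intro: summable_on_add)

lemma (in irreducible_blocks) abs_summable_path_prod:
  assumes "z \<noteq> 0" and v: "supersol A (ln (cmod z)) s2 v" "\<And>k. 0 < v $ k"
  shows "(\<lambda>xs. norm (path_prod A z xs)) summable_on excursions"
proof (rule Infinite_Sum.abs_summable_on_comparison_test')
  show "(\<lambda>xs. \<Sum>k\<in>UNIV. \<Sum>l\<in>UNIV. real_path_prod A (cmod z) xs $ k $ l) summable_on excursions"
    using assms(1) by (intro summable_on_sum summable_on_excursions[OF _ v]) simp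
  fix xs assume "xs \<in> excursions"
  then have "cmod (path_prod A z xs $ k $ l) \<le> real_path_prod A (cmod z) xs $ k $ l" for k l
    by (intro path_prod_le) (simp add: excursions_def)
  then show "norm (path_prod A z xs) \<le> (\<Sum>k\<in>UNIV. \<Sum>l\<in>UNIV. real_path_prod A (cmod z) xs $ k $ l)"
    by (intro order_trans[OF norm_matrix_le] sum_mono)
qed

lemma summable_norm_bounded_linear:
  fixes f :: "nat \<Rightarrow> 'a::real_normed_vector" and h :: "'a \<Rightarrow> 'b::real_normed_vector"
  assumes h: "bounded_linear h" and f: "summable (\<lambda>n. norm (f n))"
  shows "summable (\<lambda>n. norm (h (f n)))"
proof -
  obtain K where "\<And>x. norm (h x) \<le> norm x * K"
    using bounded_linear.bounded[OF h] by blast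
  then show ?thesis
    by (intro summable_comparison_test'[OF summable_mult2[OF f], of 0]) simp
qed

text \<open>The matrix identities are algebra on top of this one analytic fact, which will be
  supplied both at z and at |z|.\<close>

locale abs_summable_paths =
  fixes A :: "'s::finite blocks" and z :: complex
  assumes summable_paths: "(\<lambda>xs. norm (path_prod A z xs)) summable_on excursions"
begin

sublocale mm: bounded_bilinear "(**) :: complex^'s^'s \<Rightarrow> complex^'s^'s \<Rightarrow> complex^'s^'s"
  by (rule bounded_bilinear_matrix_mult)

lemma has_sum_paths: "(path_prod A z has_sum infsum (path_prod A z) excursions) excursions"
  using summable_paths by (intro has_sum_infsum) (rule abs_summable_summable)

lemma Q11_sums_infsum: "(\<lambda>n. Q11 A n z) sums infsum (path_prod A z) excursions"
  using has_sum_sums_fibres[OF has_sum_paths, of length] finite_I_set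
  by (simp add: I_set_eq Q11_eq)

lemma summable_norm_Q11: "summable (\<lambda>n. norm (Q11 A n z))"
proof (rule summable_comparison_test'[of _ 0])
  have "((\<lambda>xs. norm (path_prod A z xs)) has_sum infsum (\<lambda>xs. norm (path_prod A z xs)) excursions) excursions"
    using summable_paths by (rule has_sum_infsum)
  from has_sum_sums_fibres[OF this, of length] show "summable (\<lambda>n. \<Sum>xs\<in>I_set n. norm (path_prod A z xs))"
    using finite_I_set by (auto simp: I_set_eq sums_iff)
qed (simp add: Q11_eq norm_sum)

lemma N1_eq_infsum: "N1 A z = infsum (path_prod A z) excursions"
  using Q11_sums_infsum by (simp add: N1_def sums_iff)

lemma Q11_sums: "(\<lambda>n. Q11 A n z) sums N1 A z"
  using Q11_sums_infsum by (simp add: N1_eq_infsum)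

lemma G1_eq: "G1 A z = N1 A z ** A_star A (-1) z"
  using bounded_linear.sums[OF mm.bounded_linear_left Q11_sums]
  by (simp add: G1_def D1_Suc sums_iff)

lemma R1_eq: "R1 A z = A_star A 1 z ** N1 A z"
  using bounded_linear.sums[OF mm.bounded_linear_right Q11_sums]
  by (simp add: R1_def U1_Suc sums_iff)

lemma abs_summable_Q11: "abs_summable_mat (\<lambda>n. Q11 A n z)"
  by (rule abs_summable_matI) (rule summable_norm_Q11)

lemma abs_summable_D1: "abs_summable_mat (\<lambda>n. D1 A (Suc n) z)"
  unfolding D1_Suc
  by (intro abs_summable_matI summable_norm_bounded_linear[OF mm.bounded_linear_left] summable_norm_Q11)

lemma abs_summable_U1: "abs_summable_mat (\<lambda>n. U1 A (Suc n) z)"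
  unfolding U1_Suc
  by (intro abs_summable_matI summable_norm_bounded_linear[OF mm.bounded_linear_right] summable_norm_Q11)

text \<open>Decomposition of an excursion at its first step and, if that step is upward, at the first
  return to level 0.\<close>

lemma N1_recursion: "N1 A z = mat 1 + H1 A z ** N1 A z"
proof -
  let ?P = "path_prod A z" and ?N = "N1 A z" and ?E = excursions
  have P: "(?P has_sum ?N) ?E" using has_sum_paths by (simp add: N1_eq_infsum)
  have level: "(?P has_sum A_star A 0 z ** ?N) ((#) 0 ` ?E)"
    using has_sum_bounded_linear[OF mm.bounded_linear_right P, of "A_star A 0 z"]
    by (subst has_sum_reindex) (simp_all add: o_def)
  \<comment> \<open>The weight of an up-down path as a bilinear map of its two inner excursions,
    with the factors in the order of the steps.\<close>
  define B where "B X Y = A_star A 1 z ** X ** (A_star A (-1) z ** Y)" for X Y :: "complex^'s^'s"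
  have "bounded_bilinear B"
    unfolding B_def
    by (intro bounded_bilinear.comp[OF mm.bounded_bilinear_axioms] mm.bounded_linear_right)
  from has_sum_bounded_bilinear[OF this summable_paths summable_paths]
  have "((\<lambda>(xs, ys). B (?P xs) (?P ys)) has_sum B ?N ?N) (?E \<times> ?E)"
    by (simp add: N1_eq_infsum)
  then have up: "(?P has_sum B ?N ?N) ((\<lambda>(xs, ys). 1 # xs @ (-1) # ys) ` (?E \<times> ?E))"
    by (subst has_sum_reindex[OF inj_up_down])
      (simp add: o_def case_prod_unfold B_def path_prod_append matrix_mul_assoc)
  have "(?P has_sum A_star A 0 z ** ?N + B ?N ?N)
      ((#) 0 ` ?E \<union> (\<lambda>(xs, ys). 1 # xs @ (-1) # ys) ` (?E \<times> ?E))"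
    using level up by (rule has_sum_Un_disjoint) auto
  then have "(?P has_sum ?P [] + (A_star A 0 z ** ?N + B ?N ?N)) ?E"
    by (subst excursions_decomp, intro has_sum_insert) auto
  then have "?N = ?P [] + (A_star A 0 z ** ?N + B ?N ?N)"
    using P has_sum_unique by blast
  then show ?thesis
    by (simp add: B_def H1_def mm.add_left matrix_mul_assoc)
qed

lemma H1_N1: "(mat 1 - H1 A z) ** N1 A z = mat 1"
  using N1_recursion by (simp add: mm.diff_left algebra_simps)

text \<open>The mirror recursion N = I + N H: a one-sided inverse of a square matrix is
  two-sided.\<close>

lemma N1_H1: "N1 A z ** (mat 1 - H1 A z) = mat 1"
  using H1_N1 matrix_left_right_inverse by blast

lemma H1_eq: "H1 A z = A_star A 0 z + A_star A 1 z ** G1 A z"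
  by (simp add: H1_def G1_eq matrix_mul_assoc)

text \<open>The recursion N = I + H N multiplied on the right by
  \<open>A_star A (-1) z\<close>.\<close>

lemma G1_equation:
  "A_star A (-1) z + A_star A 0 z ** G1 A z + A_star A 1 z ** (G1 A z ** G1 A z) = G1 A z"
proof -
  have "A_star A (-1) z + A_star A 0 z ** G1 A z + A_star A 1 z ** (G1 A z ** G1 A z)
      = A_star A (-1) z + H1 A z ** G1 A z"
    by (simp add: H1_eq mm.add_left matrix_mul_assoc add.assoc)
  also have "\<dots> = (mat 1 + H1 A z ** N1 A z) ** A_star A (-1) z"
    by (simp add: G1_eq mm.add_left matrix_mul_assoc)
  also have "\<dots> = G1 A z" by (simp add: G1_eq flip: N1_recursion)
  finally show ?thesis .
qed

text \<open>The mirror recursion N = I + N H multiplied on the left by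
  \<open>A_star A 1 z\<close>.\<close>

lemma R1_equation:
  "(R1 A z ** R1 A z) ** A_star A (-1) z + R1 A z ** A_star A 0 z + A_star A 1 z = R1 A z"
proof -
  have "N1 A z ** H1 A z = N1 A z - mat 1"
    using N1_H1 by (simp add: mm.diff_right algebra_simps)
  then have "A_star A 1 z ** (N1 A z ** H1 A z) = R1 A z - A_star A 1 z"
    by (simp add: mm.diff_right R1_eq)
  moreover have "(R1 A z ** R1 A z) ** A_star A (-1) z + R1 A z ** A_star A 0 z
      = A_star A 1 z ** (N1 A z ** H1 A z)"
    by (simp add: H1_def R1_eq mm.add_right matrix_mul_assoc)
  ultimately show ?thesis by simp
qed

text \<open>With K = I - H, the two inverse relations give R K = A_1 and K G = A_{-1}. The product
  thus expands to K - w^{-1} A_{-1} - w A_1 + A_1 N A_{-1}, and the last term cancels the one hidden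
  in H.\<close>

lemma factorization:
  assumes "w \<noteq> 0"
  shows "mat 1 - C_mat A z w = (mat (inverse w) - R1 A z) ** (mat 1 - H1 A z) ** (mat w - G1 A z)"
proof -
  let ?a = "A_star A (-1) z" and ?b = "A_star A 0 z" and ?c = "A_star A 1 z"
    and ?N = "N1 A z"
  define K where "K = mat 1 - H1 A z"
  \<comment> \<open>Scalars enter as scalar matrices; these rules make them move freely through
    products.\<close>
  have mat_left: "mat u ** X = (\<chi> k l. u * X $ k $ l)"
    and mat_right: "X ** mat u = (\<chi> k l. u * X $ k $ l)" for u :: complex and X :: "complex^'s^'s"
    by (simp_all add: matrix_matrix_mult_def mat_def vec_eq_iff if_distrib if_distribR mult.commute
      cong: if_cong)
  have C: "C_mat A z w = mat (inverse w) ** ?a + ?b + ?c ** mat w"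
    by (simp add: C_mat_def A_star_def HH_def mat_left mat_right vec_eq_iff algebra_simps)
  have "(mat (inverse w) - R1 A z) ** K = mat (inverse w) ** K - ?c ** (?N ** K)"
    by (simp add: R1_eq mm.diff_left matrix_mul_assoc)
  then have "(mat (inverse w) - R1 A z) ** K ** (mat w - G1 A z)
      = (mat (inverse w) ** K - ?c) ** (mat w - G1 A z)"
    using N1_H1 by (simp add: K_def)
  also have "\<dots> = mat (inverse w) ** K ** mat w - mat (inverse w) ** (K ** ?N) ** ?a
        - (?c ** mat w - ?c ** ?N ** ?a)"
    by (simp add: G1_eq mm.diff_left mm.diff_right matrix_mul_assoc)
  also have "mat (inverse w) ** K ** mat w = K"
    using assms by (simp add: mat_left mat_right vec_eq_iff)
  also have "K ** ?N = mat 1"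
    using H1_N1 by (simp add: K_def)
  also have "K - mat (inverse w) ** mat 1 ** ?a - (?c ** mat w - ?c ** ?N ** ?a) = mat 1 - C_mat A z w"
    by (simp add: C H1_def K_def)
  finally show ?thesis by (simp add: K_def)
qed

end

section \<open>Entrywise domination by the values at |z|\<close>

lemma (in irreducible_blocks) mat_abs_A_star_le:
  "j \<in> HH \<Longrightarrow> mat_le (mat_abs (A_star A j z)) (A_star A j (complex_of_real (cmod z)))"
  using A_star_le by (simp add: mat_le_def mat_abs_def A_star_of_real cmat_def less_eq_complex_def)

lemma (in irreducible_blocks) mat_abs_N1_le:
  assumes "z \<noteq> 0" and v: "supersol A (ln (cmod z)) s2 v" "\<And>k. 0 < v $ k"
  shows "mat_le (mat_abs (N1 A z)) (N1 A (complex_of_real (cmod z)))"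
proof -
  let ?x = "complex_of_real (cmod z)"
  interpret z: abs_summable_paths A z
    by standard (rule abs_summable_path_prod[OF assms])
  interpret x: abs_summable_paths A ?x
    by standard (rule abs_summable_path_prod, use assms in auto)
  have "complex_of_real (cmod (N1 A z $ k $ l)) \<le> N1 A ?x $ k $ l" for k l
  proof -
    have bl: "bounded_linear (\<lambda>X :: complex^'s^'s. X $ k $ l)"
      using bounded_linear_compose[OF bounded_linear_vec_nth bounded_linear_vec_nth] .
    \<comment> \<open>\<open>T\<close> is the sum of the dominating real weights, path by path; it
      turns out to be the entry of \<open>N1\<close> at |z|.\<close>
    obtain T where T: "((\<lambda>xs. real_path_prod A (cmod z) xs $ k $ l) has_sum T) excursions"
      using summable_on_excursions[OF _ v] assms(1) by (auto simp: summable_on_def)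
    have "((\<lambda>xs. path_prod A z xs $ k $ l) has_sum N1 A z $ k $ l) excursions"
      using has_sum_bounded_linear[OF bl z.has_sum_paths] by (simp add: z.N1_eq_infsum)
    then have "cmod (N1 A z $ k $ l) \<le> T"
      using T by (rule norm_infsum_le) (simp add: excursions_def path_prod_le)
    moreover have "((\<lambda>xs. complex_of_real (real_path_prod A (cmod z) xs $ k $ l)) has_sum N1 A ?x $ k $ l)
        excursions"
      using has_sum_bounded_linear[OF bl x.has_sum_paths]
      by (simp add: x.N1_eq_infsum path_prod_of_real cmat_def)
    then have "N1 A ?x $ k $ l = complex_of_real T"
      using has_sum_of_real[OF T] has_sum_unique by blast
    ultimately show ?thesis by (simp add: less_eq_complex_def)
  qed
  then show ?thesis by (simp add: mat_le_def mat_abs_def)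
qed

theorem lemma4p1:
  fixes A A1 A2 :: "int \<Rightarrow> int \<Rightarrow> real^'s::finite^'s" and z :: complex
  assumes "\<forall>i\<in>HH. \<forall>j\<in>HH. nonneg_mat (A i j)"
    and "\<forall>i\<in>HH. \<forall>j\<in>HHp. nonneg_mat (A1 i j)"
    and "\<forall>i\<in>HHp. \<forall>j\<in>HH. nonneg_mat (A2 i j)"
    and "stochastic (\<Sum>i\<in>HH. \<Sum>j\<in>HH. A i j)"
    and "stochastic (\<Sum>i\<in>HH. \<Sum>j\<in>HHp. A1 i j)"
    and "stochastic (\<Sum>i\<in>HHp. \<Sum>j\<in>HH. A2 i j)"
    and "irreducible_chain states0 (chain0 A)" "aperiodic_chain states0 (chain0 A)"
    and "irreducible_chain states1 (chain1 A A1)" "aperiodic_chain states1 (chain1 A A1)"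
    and "irreducible_chain states2 (chain2 A A2)" "aperiodic_chain states2 (chain2 A A2)"
    and "z1_lo A \<le> cmod z" "cmod z \<le> z1_hi A"
  shows
    "(abs_summable_mat (\<lambda>n. Q11 A n z) \<and>
      abs_summable_mat (\<lambda>n. D1 A (Suc n) z) \<and>
      abs_summable_mat (\<lambda>n. U1 A (Suc n) z) \<and>
      mat_le (mat_abs (N1 A z)) (N1 A (complex_of_real (cmod z))) \<and>
      mat_le (mat_abs (G1 A z)) (G1 A (complex_of_real (cmod z))) \<and>
      mat_le (mat_abs (R1 A z)) (R1 A (complex_of_real (cmod z)))) \<and>
     (G1 A z = N1 A z ** A_star A (-1) z \<and>
      R1 A z = A_star A 1 z ** N1 A z) \<and>
     (A_star A (-1) z + A_star A 0 z ** G1 A z + A_star A 1 z ** (G1 A z ** G1 A z) = G1 A z \<and>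
      (R1 A z ** R1 A z) ** A_star A (-1) z + R1 A z ** A_star A 0 z + A_star A 1 z = R1 A z) \<and>
     (mat 1 - H1 A z) ** N1 A z = mat 1 \<and>
     (\<forall>w. w \<noteq> 0 \<longrightarrow>
       mat 1 - C_mat A z w =
       (mat (inverse w) - R1 A z) ** (mat 1 - H1 A z) ** (mat w - G1 A z))"
proof -
  interpret irreducible_blocks A
  proof
    show "0 \<le> A i j $ k $ l" if "i \<in> HH" "j \<in> HH" for i j k l
      using assms(1) that by (simp add: nonneg_mat_def)
    show "(\<Sum>l\<in>UNIV. \<Sum>i\<in>HH. \<Sum>j\<in>HH. A i j $ k $ l) = 1" for k
      using assms(4) by (simp add: stochastic_def)
  qed (rule assms(7))
  have "0 < cmod z"
    using assms(13) unfolding z1_lo_def by (rule order_less_le_trans[OF exp_gt_zero])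
  then have z: "z \<noteq> 0" by simp
  obtain s2 v where v: "supersol A (ln (cmod z)) s2 v" "\<And>k. 0 < v $ k"
    by (rule exists_positive_supersol[OF assms(13,14)]) (rule that)
  let ?x = "complex_of_real (cmod z)"
  interpret z: abs_summable_paths A z
    by standard (rule abs_summable_path_prod[OF z v])
  interpret x: abs_summable_paths A ?x
    by standard (rule abs_summable_path_prod, use z v in auto)
  note N = mat_abs_N1_le[OF z v]
  \<comment> \<open>The product formulas of (ii), valid at z and at |z|, pass the bound for
    \<open>N1\<close> on to \<open>G1\<close> and \<open>R1\<close>.\<close>
  have "mat_le (mat_abs (G1 A z)) (G1 A ?x)"
    unfolding z.G1_eq x.G1_eq by (intro mat_abs_mult_le N mat_abs_A_star_le) (simp add: HH_def)
  moreover have "mat_le (mat_abs (R1 A z)) (R1 A ?x)"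
    unfolding z.R1_eq x.R1_eq by (intro mat_abs_mult_le N mat_abs_A_star_le) (simp add: HH_def)
  ultimately show ?thesis
    using N z.abs_summable_Q11 z.abs_summable_D1 z.abs_summable_U1 z.G1_eq z.R1_eq
      z.G1_equation z.R1_equation z.H1_N1 z.factorization by blast
qed

end
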